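(* Let $P$ be a set of $n$ points in $\mathbb{R}^2$ such that $P$ is not contained in the union of two lines, and suppose $n > 7697$. Then $P$ contains an $11$-ordinary triangle.
   Context: For a finite point set $P\subset\mathbb{R}^2$, a line is called a spanned line if it contains at least two points of $P$. For an integer $c$, a $c$-ordinary triangle in $P$ is a set of three non-collinear points of $P$ such that each of the three lines spanned by pairs of these points contains at most $c$ points of $P$. *)

theory Defs
  imports Main "HOL-Analysis.Analysis"
begin

type_synonym point = "real \<times> real"

definition is_line :: "point set \<Rightarrow> bool" where
  "is_line L \<longleftrightarrow> (\<exists>a b c. (a \<noteq> 0 \<or> b \<noteq> 0) \<and> L = {p. a * fst p + b * snd p = c})"

definition line_through :: "point \<Rightarrow> point \<Rightarrow> point set" where
  "line_through p q = {r. (fst q - fst p) * (snd r - snd p) - (snd q - snd p) * (fst r - fst p) = 0}"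

definition collinear3 :: "point \<Rightarrow> point \<Rightarrow> point \<Rightarrow> bool" where
  "collinear3 p q r \<longleftrightarrow> (fst q - fst p) * (snd r - snd p) - (snd q - snd p) * (fst r - fst p) = 0"

definition c_ordinary_triangle :: "nat \<Rightarrow> point set \<Rightarrow> point \<Rightarrow> point \<Rightarrow> point \<Rightarrow> bool" where
  "c_ordinary_triangle c P a b d \<longleftrightarrow>
     a \<in> P \<and> b \<in> P \<and> d \<in> P \<and> \<not> collinear3 a b d \<and>
     card (P \<inter> line_through a b) \<le> c \<and>
     card (P \<inter> line_through b d) \<le> c \<and>
     card (P \<inter> line_through a d) \<le> c"

end

theory Submission
  imports Defs "HOL-Combinatorics.Orbits"
begin

text \<open>
  Dualise: the points of \<open>P\<close> become great circles on the sphere and a spanned line with \<open>k\<close> points of \<open>P\<close>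
  becomes a pair of antipodal vertices of multiplicity \<open>k\<close>. Write \<open>f\<close> and \<open>k\<close> for the length of the face
  and the multiplicity of the vertex at a corner. By Euler's formula the sum of \<open>4/f + 2/k - 2\<close> over all
  corners is positive.

  If there is no \<open>11\<close>-ordinary triangle, then every triangular face has a vertex of multiplicity at least
  \<open>12\<close>, so its corners contribute at most \<open>1/6\<close>, and a positive amount only if the other two vertices have
  multiplicity \<open>2\<close>. Such a face sends its \<open>1/6\<close> across the edge opposite the rich vertex \<open>A\<close> and on through
  opposite sides of quadrilaterals whose corners all have multiplicity \<open>2\<close>. This ladder ends in a face
  whose contribution is negative enough to pay \<open>1/6\<close> for every ladder ending there, unless it ends in a
  triangle. In that case all vertices other than \<open>A\<close> on some line \<open>p\<close> through \<open>A\<close> have multiplicity \<open>2\<close>. Then no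
  two points of \<open>P\<close> outside \<open>A\<close> span an ordinary line, and they are collinear by the Sylvester--Gallai theorem,
  which is itself a consequence of the same Euler formula.
\<close>

section \<open>Permutations and trails\<close>

text \<open>A cycle of length m contributes m times 1/m, so a sum over darts can count the
  faces.\<close>

lemma sum_inverse_card_orbit:
  fixes f :: "'a \<Rightarrow> 'a"
  assumes "f permutes S" "finite S"
  shows "(\<Sum>x\<in>S. 1 / real (card (orbit f x))) = card (orbit f ` S)"
proof -
  have perm: "permutation f" using assms permutation_permutes by blast
  have sub: "orbit f x \<subseteq> S" if "x \<in> S" for x using permutes_orbit_subset assms(1) that .
  have "(\<Sum>x\<in>S. 1 / real (card (orbit f x)))
      = (\<Sum>C\<in>orbit f ` S. \<Sum>x\<in>{x\<in>S. orbit f x = C}. 1 / real (card (orbit f x)))"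
    using assms(2) by (intro sum.image_gen)
  also have "\<dots> = (\<Sum>C\<in>orbit f ` S. 1)"
  proof (intro sum.cong refl)
    fix C assume "C \<in> orbit f ` S"
    then obtain y where y: "y \<in> S" "C = orbit f y" by blast
    have eq: "{x\<in>S. orbit f x = C} = C"
      using sub[OF y(1)] y(2) permutation_self_in_orbit[OF perm]
        orbit_cyclic_eq3[OF cyclic_on_orbit'[OF perm]] by blast
    have "finite C" "C \<noteq> {}"
      using y orbit_nonempty[of f y] sub[OF y(1)] assms(2) finite_subset[of C S] by auto
    moreover have "(\<Sum>x\<in>{x\<in>S. orbit f x = C}. 1 / real (card (orbit f x)))
        = (\<Sum>x\<in>{x\<in>S. orbit f x = C}. 1 / real (card C))"
      by (intro sum.cong) auto
    ultimately show "(\<Sum>x\<in>{x\<in>S. orbit f x = C}. 1 / real (card (orbit f x))) = 1"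
      using eq by simp
  qed
  finally show ?thesis by simp
qed

lemma funpow_card_orbit:
  assumes "permutation f"
  shows "(f ^^ card (orbit f x)) x = x"
proof -
  have x: "x \<in> orbit f x" using permutation_self_in_orbit[OF assms] .
  have "orbit f x = (\<lambda>n. (f ^^ n) x) ` {0..<funpow_dist1 f x x}"
    using orbit_conv_funpow_dist1[OF x] .
  moreover have "inj_on (\<lambda>n. (f ^^ n) x) {0..<funpow_dist1 f x x}"
    using inj_on_funpow_dist1[OF x] .
  ultimately have "card (orbit f x) = funpow_dist1 f x x" by (metis card_image card_atLeastLessThan diff_zero)
  then show ?thesis using funpow_dist1_prop[OF x] by metis
qed

lemma card_orbit_ge_3:
  assumes "permutation f" "f x \<noteq> x" "f (f x) \<noteq> x"
  shows "3 \<le> card (orbit f x)"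
proof -
  have "finite (orbit f x)" using finite_orbit permutation_self_in_orbit[OF assms(1)] .
  moreover have "{x, f x, f (f x)} \<subseteq> orbit f x"
    using permutation_self_in_orbit[OF assms(1)] by (auto intro: orbit.intros)
  moreover have "f (f x) \<noteq> f x" using assms by (metis permutation bij_pointE)
  ultimately show ?thesis using assms card_mono[of "orbit f x" "{x, f x, f (f x)}"] by auto
qed

text \<open>Shifts the corners of all faces of a given length by one place inside a sum.\<close>

lemma sum_permutes:
  assumes "f permutes S" "\<And>x. x \<in> S \<Longrightarrow> f x \<in> A \<longleftrightarrow> x \<in> A" "A \<subseteq> S"
  shows "(\<Sum>x\<in>A. g (f x)) = sum g A"
proof -
  have inj: "inj_on f A" using permutes_inj[OF assms(1)] inj_on_subset by blast
  have "f ` A = A"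
  proof
    show "f ` A \<subseteq> A" using assms by blast
    show "A \<subseteq> f ` A"
    proof
      fix x assume x: "x \<in> A"
      then obtain y where "y \<in> S" "x = f y" using assms permutes_image by blast
      then show "x \<in> f ` A" using assms x by blast
    qed
  qed
  then show ?thesis using sum.reindex[OF inj, of g] by (simp add: o_def)
qed

text \<open>A trail of \<open>N\<close> that starts outside the range of \<open>N\<close> cannot close up, so it leaves \<open>Q\<close>,
  and distinct trails leave it at distinct points.\<close>
lemma card_trail_starts_le:
  assumes "finite X" "inj_on N Q" "N ` Q \<subseteq> X" "Q \<subseteq> X" "S \<subseteq> X" "S \<inter> N ` Q = {}"
    and avoid: "\<And>s t. s \<in> S \<Longrightarrow> (\<forall>i<t. (N ^^ i) s \<in> Q) \<Longrightarrow> (N ^^ t) s \<notin> B"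
  shows "card S \<le> card (X - Q - B)"
proof -
  \<comment> \<open>Two trails that meet can be traced back together, because \<open>N\<close> is
    injective on \<open>Q\<close>, until the shorter one is at its start.\<close>
  have cancel: "\<exists>j. (N ^^ j) a = b \<and> j + i = t"
    if "(N ^^ i) b = (N ^^ t) a" "i \<le> t" "\<forall>j<i. (N ^^ j) b \<in> Q" "\<forall>j<t. (N ^^ j) a \<in> Q" for i t a b
    using that
  proof (induction i arbitrary: t)
    case 0 then show ?case by auto
  next
    case (Suc i)
    then obtain t' where t': "t = Suc t'" by (cases t) auto
    have "(N ^^ i) b = (N ^^ t') a"
    proof (rule inj_onD[OF assms(2)])
      show "N ((N ^^ i) b) = N ((N ^^ t') a)" using Suc.prems(1) t' by simp
      show "(N ^^ i) b \<in> Q" "(N ^^ t') a \<in> Q" using Suc.prems(3,4) t' by simp_all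
    qed
    then show ?case using Suc.IH[of t'] Suc.prems t' by auto
  qed
  have cancel0: "b = a \<and> i = t"
    if "(N ^^ i) b = (N ^^ t) a" "i \<le> t" "\<forall>j<i. (N ^^ j) b \<in> Q" "\<forall>j<t. (N ^^ j) a \<in> Q" "b \<in> S" for i t a b
  proof -
    have "\<exists>j. (N ^^ j) a = b \<and> j + i = t" using that by (intro cancel) auto
    then obtain j where j: "(N ^^ j) a = b" "j + i = t" by blast
    \<comment> \<open>A start in \<open>S\<close> has no predecessor in \<open>Q\<close>, so the
      longer trail cannot pass through it.\<close>
    have "j = 0"
    proof (rule ccontr)
      assume "j \<noteq> 0"
      then obtain k where k: "j = Suc k" by (cases j) auto
      then have "b \<in> N ` Q" using j that(4) by auto
      then show False using that(5) assms(6) by blast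
    qed
    then show ?thesis using j by auto
  qed
  have "\<exists>t. (N ^^ t) s \<notin> Q" if s: "s \<in> S" for s
  proof (rule ccontr)
    assume "\<not> ?thesis"
    then have all: "(N ^^ t) s \<in> Q" for t by blast
    have "inj (\<lambda>t. (N ^^ t) s)"
    proof (rule injI)
      fix i t assume "(N ^^ i) s = (N ^^ t) s"
      then show "i = t"
        using cancel0[of i s t s] cancel0[of t s i s] all s by (cases "i \<le> t") auto
    qed
    moreover have "range (\<lambda>t. (N ^^ t) s) \<subseteq> X" using all assms(4) by blast
    ultimately show False
      using assms(1) finite_subset range_inj_infinite by blast
  qed
  then have ex: "\<exists>t. (N ^^ t) s \<notin> Q \<and> (\<forall>i<t. (N ^^ i) s \<in> Q)" if "s \<in> S" for s
    using exists_least_iff[of "\<lambda>t. (N ^^ t) s \<notin> Q"] that by auto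
  then obtain e where e: "\<And>s. s \<in> S \<Longrightarrow> (N ^^ e s) s \<notin> Q"
    "\<And>s i. s \<in> S \<Longrightarrow> i < e s \<Longrightarrow> (N ^^ i) s \<in> Q" by metis
  have inX: "(N ^^ e s) s \<in> X" if "s \<in> S" for s
  proof (cases "e s")
    case 0 then show ?thesis using that assms(5) by auto
  next
    case (Suc k) then show ?thesis using e(2)[OF that, of k] assms(3) by auto
  qed
  show ?thesis
  proof (rule card_inj_on_le)
    show "inj_on (\<lambda>s. (N ^^ e s) s) S"
    proof (rule inj_onI)
      fix a b assume "a \<in> S" "b \<in> S" "(N ^^ e a) a = (N ^^ e b) b"
      then show "a = b"
        using cancel0[of "e a" a "e b" b] cancel0[of "e b" b "e a" a] e by (cases "e a \<le> e b") auto
    qed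
    show "(\<lambda>s. (N ^^ e s) s) ` S \<subseteq> X - Q - B" using inX e avoid by blast
    show "finite (X - Q - B)" using assms(1) by blast
  qed
qed

section \<open>Rotating coordinates\<close>

text \<open>Lines of direction \<open>\<theta>\<close> are the level sets of
  \<open>hc \<theta>\<close>, and \<open>tc \<theta>\<close> is the position along them. The dual
  curve of \<open>p\<close> is the graph of \<open>hc \<theta> p\<close> over
  \<open>\<theta>\<close> on the cylinder of oriented lines, a great circle after central projection
  to the sphere.\<close>

definition hc :: "real \<Rightarrow> point \<Rightarrow> real" where
  "hc \<theta> p = snd p * cos \<theta> - fst p * sin \<theta>"

definition tc :: "real \<Rightarrow> point \<Rightarrow> real" where
  "tc \<theta> p = fst p * cos \<theta> + snd p * sin \<theta>"

lemma hc_diff: "hc \<theta> (p - q) = hc \<theta> p - hc \<theta> q" and tc_diff: "tc \<theta> (p - q) = tc \<theta> p - tc \<theta> q"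
  by (simp_all add: hc_def tc_def algebra_simps)

lemma hc_add_angle: "hc (\<theta> + x) p = hc \<theta> p * cos x - tc \<theta> p * sin x"
  and tc_add_angle: "tc (\<theta> + x) p = tc \<theta> p * cos x + hc \<theta> p * sin x"
  by (simp_all add: hc_def tc_def cos_add sin_add algebra_simps)

lemma hc_tc_eq_0: 
  assumes "hc \<theta> p = 0" "tc \<theta> p = 0" shows "p = 0"
proof -
  have "(hc \<theta> p)\<^sup>2 + (tc \<theta> p)\<^sup>2 = ((fst p)\<^sup>2 + (snd p)\<^sup>2) * ((sin \<theta>)\<^sup>2 + (cos \<theta>)\<^sup>2)"
    unfolding hc_def tc_def by algebra
  then have "(fst p)\<^sup>2 + (snd p)\<^sup>2 = 0" using assms by simp
  then show ?thesis by (simp add: sum_power2_eq_zero_iff prod_eq_iff)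
qed

lemma hc_tc_eqI: "hc \<theta> p = hc \<theta> q \<Longrightarrow> tc \<theta> p = tc \<theta> q \<Longrightarrow> p = q"
  using hc_tc_eq_0[of \<theta> "p - q"] by (simp add: hc_diff tc_diff)

text \<open>On \<open>p - q\<close> the coordinate \<open>hc\<close> vanishes at
  \<open>\<theta>\<close>, so \<open>tc\<close> does not, and the addition formula leaves
  \<open>tc \<theta> (p - q) * sin x = 0\<close>. Thus two dual curves meet only at antipodal
  vertices.\<close>

lemma sin_eq_0_if_hc:
  assumes "hc \<theta> p = hc \<theta> q" "hc (\<theta> + x) p = hc (\<theta> + x) q" "p \<noteq> q"
  shows "sin x = 0"
proof -
  have "hc \<theta> (p - q) = 0" "hc (\<theta> + x) (p - q) = 0" using assms by (simp_all add: hc_diff)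
  then have "tc \<theta> (p - q) * sin x = 0" by (simp add: hc_add_angle)
  moreover have "tc \<theta> (p - q) \<noteq> 0" using hc_tc_eqI[of \<theta> p q] assms by (auto simp: tc_diff)
  ultimately show ?thesis by simp
qed

lemma hc_add_pi_mult:
  assumes "sin x = 0" shows "hc (\<theta> + x) p = hc (\<theta> + x) q \<longleftrightarrow> hc \<theta> p = hc \<theta> q"
proof -
  have "cos x \<noteq> 0" using assms sin_cos_squared_add[of x] by auto
  then show ?thesis using assms by (simp add: hc_add_angle)
qed

lemma cross_hc_tc:
  "(fst q - fst p) * (snd r - snd p) - (snd q - snd p) * (fst r - fst p)
    = tc \<theta> (q - p) * hc \<theta> (r - p) - hc \<theta> (q - p) * tc \<theta> (r - p)"
proof -
  have "(x * c + y * s) * (w * c - z * s) - (y * c - x * s) * (z * c + w * s) = (x * w - y * z) * (s\<^sup>2 + c\<^sup>2)"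
    for x y z w s c :: real by algebra
  then show ?thesis by (simp add: hc_def tc_def)
qed

lemma line_through_iff:
  assumes "hc \<theta> p = hc \<theta> q" "p \<noteq> q"
  shows "r \<in> line_through p q \<longleftrightarrow> hc \<theta> r = hc \<theta> p"
proof -
  have "tc \<theta> (q - p) \<noteq> 0" using hc_tc_eqI[of \<theta> p q] assms by (auto simp: tc_diff)
  moreover have "hc \<theta> (q - p) = 0" using assms by (simp add: hc_diff)
  ultimately show ?thesis 
    unfolding line_through_def mem_Collect_eq cross_hc_tc[of q p r \<theta>] by (simp add: hc_diff)
qed

lemma collinear3_iff:
  assumes "hc \<theta> p = hc \<theta> q" "p \<noteq> q"
  shows "collinear3 p q r \<longleftrightarrow> hc \<theta> r = hc \<theta> p"
  using line_through_iff[OF assms] by (simp add: line_through_def collinear3_def)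

text \<open>By \<open>neg\<close> the sinusoid is negative just after 0, where its derivative is
  \<open>- b\<close>. Having no zero before \<open>d\<close>, it is still negative just before
  \<open>d\<close>. So it is negative at \<open>d\<close> or rises to 0 there, with derivative
  \<open>- (b * cos d + a * sin d)\<close>.\<close>

lemma sinusoid_sign:
  fixes a b d :: real
  assumes "0 < d" "d \<le> pi" and nz: "\<And>x. 0 < x \<Longrightarrow> x < d \<Longrightarrow> a * cos x - b * sin x \<noteq> 0"
    and neg: "a < 0 \<or> a = 0 \<and> 0 < b"
  shows "a * cos d - b * sin d < 0 \<or> a * cos d - b * sin d = 0 \<and> b * cos d + a * sin d < 0"
proof (cases "a = 0")
  case True
  then show ?thesis using neg assms(1,2) sin_gt_zero[of d] by (cases "d = pi") auto
next
  case False
  then have a: "a < 0" using neg by auto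
  have "\<not> 0 < a * cos d - b * sin d"
  proof
    assume pos: "0 < a * cos d - b * sin d"
    have "\<exists>x\<ge>0. x \<le> d \<and> a * cos x - b * sin x = 0"
      using a pos assms(1) by (intro IVT') (auto intro!: continuous_intros)
    then obtain x where x: "0 \<le> x" "x \<le> d" "a * cos x - b * sin x = 0" by blast
    then have "0 < x" "x < d" using a pos by (auto simp: order.order_iff_strict)
    then show False using nz x by blast
  qed
  moreover have "b * cos d + a * sin d < 0" if z: "a * cos d - b * sin d = 0"
  proof -
    have "d \<noteq> pi" using z a by auto
    then have s: "0 < sin d" using assms sin_gt_zero[of d] by auto
    have "(b * cos d + a * sin d) * sin d = a"
      using z sin_cos_squared_add[of d] by algebra
    then show ?thesis using a s by (smt (verit) mult_nonneg_nonneg)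
  qed
  ultimately show ?thesis by linarith
qed

section \<open>Angles modulo a full turn\<close>

definition wrap :: "real \<Rightarrow> real" where
  "wrap x = x - 2 * pi * \<lfloor>x / (2 * pi)\<rfloor>"

lemma wrap_range: "0 \<le> wrap x" "wrap x < 2 * pi"
proof -
  have "of_int \<lfloor>x / (2 * pi)\<rfloor> \<le> x / (2 * pi)" "x / (2 * pi) < of_int \<lfloor>x / (2 * pi)\<rfloor> + 1"
    by linarith+
  then have "of_int \<lfloor>x / (2 * pi)\<rfloor> * (2 * pi) \<le> x" "x < (of_int \<lfloor>x / (2 * pi)\<rfloor> + 1) * (2 * pi)"
    by (simp_all only: pos_le_divide_eq pos_divide_less_eq pi_gt_zero mult_pos_pos zero_less_numeral)
  then show "0 \<le> wrap x" "wrap x < 2 * pi"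
    unfolding wrap_def by (simp_all add: algebra_simps)
qed

lemma wrap_add_int: "wrap (x + 2 * pi * of_int k) = wrap x"
proof -
  have "(x + 2 * pi * of_int k) / (2 * pi) = x / (2 * pi) + of_int k" by (simp add: field_simps)
  then show ?thesis unfolding wrap_def by (simp add: algebra_simps)
qed

lemma wrap_id: "0 \<le> x \<Longrightarrow> x < 2 * pi \<Longrightarrow> wrap x = x"
  unfolding wrap_def by (simp add: floor_eq_iff)

lemma wrap_eq: obtains k :: int where "wrap x = x + 2 * pi * of_int k"
  using that[of "- \<lfloor>x / (2 * pi)\<rfloor>"] unfolding wrap_def by simp

lemma wrap_wrap_add: "wrap (wrap x + y) = wrap (x + y)"
proof -
  obtain k :: int where "wrap x = x + 2 * pi * of_int k" using wrap_eq .
  then show ?thesis using wrap_add_int[of "x + y" k] by (simp add: algebra_simps)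
qed

lemma hc_2pi: "hc (x + 2 * pi * of_int k) p = hc x p" and tc_2pi: "tc (x + 2 * pi * of_int k) p = tc x p"
  using sin_int_2pin[of k] cos_int_2pin[of k] by (simp_all add: hc_add_angle tc_add_angle)

lemma hc_wrap [simp]: "hc (wrap x) p = hc x p" and tc_wrap [simp]: "tc (wrap x) p = tc x p"
  using hc_2pi tc_2pi wrap_eq[of x] by metis+

text \<open>The difference of the two heights changes sign over a half turn. The range is open at 0
  and closed at pi, so that points of equal height at \<open>\<theta>\<close> itself meet at
  pi.\<close>

lemma ex_angle:
  assumes "s = 1 \<or> s = - 1"
  shows "\<exists>x. 0 < x \<and> x \<le> pi \<and> hc (\<theta> + s * x) q = hc (\<theta> + s * x) p"
proof (cases "hc \<theta> q = hc \<theta> p")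
  case True
  then show ?thesis using assms hc_add_pi_mult[of "s * pi" \<theta> q p] by (intro exI[of _ pi]) auto
next
  case False
  define v where "v = q - p"
  define f where "f x = hc (\<theta> + s * x) v" for x
  have f0: "f 0 \<noteq> 0" using False by (simp add: f_def v_def hc_diff)
  have fpi: "f pi = - f 0" using assms unfolding f_def by (auto simp: hc_add_angle)
  have cont: "continuous_on {0..pi} f" unfolding f_def hc_def by (auto intro!: continuous_intros)
  have "\<exists>x. 0 \<le> x \<and> x \<le> pi \<and> f x = 0"
  proof (cases "f 0 < 0")
    case True then show ?thesis using IVT'[of f 0 0 pi] cont fpi by auto
  next
    case False then show ?thesis using IVT2'[of f pi 0 0] cont fpi f0 by auto
  qed
  then obtain x where "0 \<le> x" "x \<le> pi" "f x = 0" by blast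
  moreover have "x \<noteq> 0" using f0 \<open>f x = 0\<close> by auto
  ultimately show ?thesis by (intro exI[of _ x]) (auto simp: f_def v_def hc_diff)
qed

lemma angle_unique:
  assumes "s = 1 \<or> s = - 1" "p \<noteq> q" "0 < x" "x \<le> pi" "0 < y" "y \<le> pi"
    "hc (\<theta> + s * x) q = hc (\<theta> + s * x) p" "hc (\<theta> + s * y) q = hc (\<theta> + s * y) p"
  shows "x = y"
proof -
  have "sin (s * (y - x)) = 0"
    using sin_eq_0_if_hc[of "\<theta> + s * x" q p "s * (y - x)"] assms by (simp add: algebra_simps)
  then have z: "sin (y - x) = 0" using assms(1) sin_minus[of "y - x"] by auto
  have "- pi < y - x" "y - x < pi" using assms by linarith+
  from sin_eq_0_pi[OF this z] show ?thesis by simp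
qed

lemma is_line_hc: "is_line {r. hc \<theta> r = c}"
proof -
  have "sin \<theta> \<noteq> 0 \<or> cos \<theta> \<noteq> 0" using sin_cos_squared_add[of \<theta>] by (metis add_0 zero_power2 zero_neq_one)
  then show ?thesis unfolding is_line_def hc_def
    by (intro exI[of _ "- sin \<theta>"] exI[of _ "cos \<theta>"] exI[of _ c]) (auto simp: algebra_simps)
qed

lemma ex_common_hc: obtains \<theta> where "hc \<theta> p = hc \<theta> q"
  using ex_angle[of 1 0 p q] by auto

lemma collinear_subset_line:
  assumes "\<And>a b c. a \<in> S \<Longrightarrow> b \<in> S \<Longrightarrow> c \<in> S \<Longrightarrow> collinear3 a b c"
  obtains L where "is_line L" "S \<subseteq> L"
proof (cases "\<exists>a\<in>S. \<exists>b\<in>S. a \<noteq> b")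
  case True
  then obtain a b where ab: "a \<in> S" "b \<in> S" "a \<noteq> b" by blast
  obtain \<theta> where \<theta>: "hc \<theta> a = hc \<theta> b" using ex_common_hc .
  have "S \<subseteq> {r. hc \<theta> r = hc \<theta> a}"
    using collinear3_iff[OF \<theta> ab(3)] assms[OF ab(1,2)] by auto
  then show ?thesis using that is_line_hc by blast
next
  case False
  then obtain a where "S \<subseteq> {a}" by blast
  then have "S \<subseteq> {r. hc 0 r = hc 0 a}" by auto
  then show ?thesis using that is_line_hc by blast
qed

section \<open>The dual arrangement as a combinatorial map\<close>

text \<open>The dart \<open>(p, \<theta>, s)\<close> is the edge of the dual great circle of \<open>p\<close> that leaves the vertex at angle \<open>\<theta>\<close>
  in the direction of increasing (\<open>s = 1\<close>) or decreasing (\<open>s = - 1\<close>) angle; the vertex itself is the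
  spanned line of direction \<open>\<theta>\<close> through \<open>p\<close>. Each spanned line gives two antipodal vertices.\<close>
type_synonym dart = "point \<times> real \<times> real"

locale point_config =
  fixes P :: "point set"
  assumes finite_P: "finite P"
    and not_collinear: "\<exists>a\<in>P. \<exists>b\<in>P. \<exists>c\<in>P. \<not> collinear3 a b c"
begin

definition blk :: "point \<Rightarrow> real \<Rightarrow> point set" where
  "blk p \<theta> = {q\<in>P. hc \<theta> q = hc \<theta> p}"

definition ev :: "point \<Rightarrow> real set" where
  "ev p = {\<theta>. \<exists>q\<in>P. q \<noteq> p \<and> hc \<theta> q = hc \<theta> p}"

text \<open>The angle to the next vertex on the dual curve of \<open>p\<close>. By
  \<open>ex_angle\<close> a half turn in either sense meets the curve of every other point, so the
  minimum is over a nonempty set.\<close>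

definition stp :: "point \<Rightarrow> real \<Rightarrow> real \<Rightarrow> real" where
  "stp p \<theta> s = Min {x. 0 < x \<and> x \<le> pi \<and> \<theta> + s * x \<in> ev p}"

definition darts :: "dart set" where
  "darts = {(p, \<theta>, s). p \<in> P \<and> \<theta> \<in> ev p \<and> 0 \<le> \<theta> \<and> \<theta> < 2 * pi \<and> (s = 1 \<or> s = - 1)}"

text \<open>The combinatorial map of the arrangement: \<open>alp\<close> reverses an edge, \<open>rho\<close> rotates about a vertex and
  \<open>phi\<close> walks around a face, which lies to the left of its darts.\<close>
fun alp :: "dart \<Rightarrow> dart" where
  "alp (p, \<theta>, s) = (p, wrap (\<theta> + s * stp p \<theta> s), - s)"

fun rho :: "dart \<Rightarrow> dart" where
  "rho (p, \<theta>, s) =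
    (if \<exists>q\<in>blk p \<theta>. tc \<theta> p < tc \<theta> q
     then (arg_min_on (tc \<theta>) {q\<in>blk p \<theta>. tc \<theta> p < tc \<theta> q}, \<theta>, s)
     else (arg_min_on (tc \<theta>) (blk p \<theta>), \<theta>, - s))"

declare rho.simps [simp del]

definition phi :: "dart \<Rightarrow> dart" where
  "phi d = (if d \<in> darts then rho (alp d) else d)"

fun mult :: "dart \<Rightarrow> nat" where
  "mult (p, \<theta>, s) = card (blk p \<theta>)"

text \<open>For \<open>s = 1\<close> the face to the left of a dart lies just above it, for \<open>s = - 1\<close> just below;
  \<open>below\<close> is the set of points on the near side, with respect to \<open>s * hc\<close>.\<close>
fun below :: "dart \<Rightarrow> point set" where
  "below (p, \<theta>, s) = {q\<in>P. s * hc \<theta> q < s * hc \<theta> p \<or> hc \<theta> q = hc \<theta> p \<and> tc \<theta> p \<le> tc \<theta> q}"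

text \<open>A face is encoded by the points whose dual curves pass below it. For
  \<open>s = - 1\<close> the set \<open>below\<close> holds the curves above the face, hence the
  complement.\<close>

fun face :: "dart \<Rightarrow> point set" where
  "face (p, \<theta>, s) = (if s = 1 then below (p, \<theta>, s) else P - below (p, \<theta>, s))"

lemma finite_blk [simp]: "finite (blk p \<theta>)"
  using finite_P by (simp add: blk_def)

lemma blk_self: "p \<in> P \<Longrightarrow> p \<in> blk p \<theta>"
  by (simp add: blk_def)

lemma blk_eq: "q \<in> blk p \<theta> \<Longrightarrow> blk q \<theta> = blk p \<theta>"
  by (auto simp: blk_def)

lemma blk_wrap [simp]: "blk p (wrap \<theta>) = blk p \<theta>"
  by (simp add: blk_def)

lemma ev_wrap [simp]: "wrap \<theta> \<in> ev p \<longleftrightarrow> \<theta> \<in> ev p"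
  by (simp add: ev_def)

lemma ev_wrap_add [simp]: "wrap \<theta> + x \<in> ev p \<longleftrightarrow> \<theta> + x \<in> ev p"
  using ev_wrap[of "wrap \<theta> + x" p] ev_wrap[of "\<theta> + x" p] by (simp add: wrap_wrap_add)

lemma stp_wrap [simp]: "stp p (wrap \<theta>) s = stp p \<theta> s"
  by (simp add: stp_def)

lemma card_blk_ge_2_iff:
  assumes "p \<in> P" shows "2 \<le> card (blk p \<theta>) \<longleftrightarrow> \<theta> \<in> ev p"
proof
  assume "2 \<le> card (blk p \<theta>)"
  then have "\<not> blk p \<theta> \<subseteq> {p}" using card_mono[of "{p}" "blk p \<theta>"] by auto
  then show "\<theta> \<in> ev p" by (auto simp: blk_def ev_def)
next
  assume "\<theta> \<in> ev p"
  then obtain q where "{p, q} \<subseteq> blk p \<theta>" "q \<noteq> p" using assms by (auto simp: blk_def ev_def)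
  then show "2 \<le> card (blk p \<theta>)" using card_mono[of "blk p \<theta>" "{p, q}"] by auto
qed

lemma ex_other: obtains q where "q \<in> P" "q \<noteq> p"
proof -
  obtain a b c where abc: "a \<in> P" "b \<in> P" "\<not> collinear3 a b c" using not_collinear by blast
  then have "a \<noteq> b" by (auto simp: collinear3_def)
  then show ?thesis using that abc by metis
qed

lemma finite_steps:
  assumes "s = 1 \<or> s = - 1"
  shows "finite {x. 0 < x \<and> x \<le> pi \<and> \<theta> + s * x \<in> ev p}"
proof -
  let ?Z = "\<lambda>q. {x. 0 < x \<and> x \<le> pi \<and> hc (\<theta> + s * x) q = hc (\<theta> + s * x) p}"
  have "finite (?Z q)" if "q \<noteq> p" for q
  proof -
    have "\<exists>z. ?Z q \<subseteq> {z}" using angle_unique[OF assms that[symmetric]] by blast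
    then show ?thesis using finite_subset by blast
  qed
  then have "finite (\<Union>q\<in>P - {p}. ?Z q)" using finite_P by auto
  then show ?thesis by (rule rev_finite_subset) (auto simp: ev_def)
qed

lemma stp:
  assumes "s = 1 \<or> s = - 1"
  shows stp_pos: "0 < stp p \<theta> s" and stp_le: "stp p \<theta> s \<le> pi"
    and stp_ev: "\<theta> + s * stp p \<theta> s \<in> ev p"
    and stp_least: "\<And>x. 0 < x \<Longrightarrow> x < stp p \<theta> s \<Longrightarrow> \<theta> + s * x \<notin> ev p"
proof -
  let ?S = "{x. 0 < x \<and> x \<le> pi \<and> \<theta> + s * x \<in> ev p}"
  obtain q where "q \<in> P" "q \<noteq> p" using ex_other .
  then have ne: "?S \<noteq> {}" using ex_angle[OF assms, of \<theta> q p] by (auto simp: ev_def)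
  have "stp p \<theta> s \<in> ?S" unfolding stp_def using Min_in[OF finite_steps[OF assms] ne] .
  then show "0 < stp p \<theta> s" and le: "stp p \<theta> s \<le> pi" and "\<theta> + s * stp p \<theta> s \<in> ev p" by auto
  show "\<theta> + s * x \<notin> ev p" if "0 < x" "x < stp p \<theta> s" for x
  proof
    assume "\<theta> + s * x \<in> ev p"
    then have "x \<in> ?S" using that le by auto
    then have "stp p \<theta> s \<le> x" unfolding stp_def using finite_steps[OF assms] by (intro Min_le)
    then show False using that by auto
  qed
qed

text \<open>If \<open>p\<close> met nothing before a half turn, it would meet all other points
  exactly at pi, and all of them would lie on its line of direction \<open>\<theta>\<close>.\<close>

lemma stp_less_pi:
  assumes "s = 1 \<or> s = - 1" "p \<in> P"
  shows "stp p \<theta> s < pi"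
proof (rule ccontr)
  assume "\<not> ?thesis"
  then have pi: "stp p \<theta> s = pi" using stp_le[OF assms(1)] by (simp add: order.antisym)
  have on_line: "hc \<theta> q = hc \<theta> p" if q: "q \<in> P" for q
  proof (cases "q = p")
    case False
    obtain x where x: "0 < x" "x \<le> pi" "hc (\<theta> + s * x) q = hc (\<theta> + s * x) p"
      using ex_angle[OF assms(1)] by blast
    then have "\<theta> + s * x \<in> ev p" using q False by (auto simp: ev_def)
    then have "x = pi" using stp_least[OF assms(1), of x p \<theta>] x pi by fastforce
    then show ?thesis using x(3) hc_add_pi_mult[of "s * pi" \<theta> q p] assms(1) by auto
  qed auto
  have "collinear3 a b c" if "a \<in> P" "b \<in> P" "c \<in> P" for a b c
  proof (cases "a = b")
    case True then show ?thesis by (simp add: collinear3_def)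
  next
    case False
    have "hc \<theta> a = hc \<theta> b" "hc \<theta> c = hc \<theta> a" using on_line that by metis+
    then show ?thesis using collinear3_iff False by blast
  qed
  then show False using not_collinear by blast
qed

lemma finite_darts: "finite darts"
proof -
  have "finite {\<theta>. 0 \<le> \<theta> \<and> \<theta> < 2 * pi \<and> \<theta> \<in> ev p}" for p
  proof -
    \<comment> \<open>\<open>finite_steps\<close> covers half a turn, so the full turn is cut into
      0, (0, pi] and (pi, 2 pi).\<close>
    have "{\<theta>. 0 \<le> \<theta> \<and> \<theta> < 2 * pi \<and> \<theta> \<in> ev p}
      \<subseteq> insert 0 ((\<lambda>x. x) ` {x. 0 < x \<and> x \<le> pi \<and> 0 + 1 * x \<in> ev p} \<union> (\<lambda>x. pi + x) ` {x. 0 < x \<and> x \<le> pi \<and> pi + 1 * x \<in> ev p})"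
      (is "?A \<subseteq> ?B")
    proof
      fix x assume "x \<in> ?A"
      then show "x \<in> ?B" by (cases "x = 0"; cases "x \<le> pi") (auto intro!: image_eqI[of x _ "x - pi"])
    qed
    moreover have "finite ?B" using finite_steps[of 1] by blast
    ultimately show ?thesis using finite_subset by blast
  qed
  then have "finite (\<Union>p\<in>P. {p} \<times> {\<theta>. 0 \<le> \<theta> \<and> \<theta> < 2 * pi \<and> \<theta> \<in> ev p} \<times> {1, - 1::real})"
    using finite_P by auto
  then show ?thesis by (rule rev_finite_subset) (auto simp: darts_def)
qed

lemma alp_in: 
  assumes "d \<in> darts" shows "alp d \<in> darts"
proof -
  obtain p \<theta> s where d: "d = (p, \<theta>, s)" using prod_cases3 .
  then show ?thesis using assms stp_ev[of s \<theta> p] wrap_range by (simp add: darts_def) force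
qed

lemma alp_alp: 
  assumes "d \<in> darts" shows "alp (alp d) = d"
proof -
  obtain p \<theta> s where d: "d = (p, \<theta>, s)" using prod_cases3 .
  let ?x = "stp p \<theta> s"
  have s: "s = 1 \<or> s = - 1" and \<theta>: "\<theta> \<in> ev p" "0 \<le> \<theta>" "\<theta> < 2 * pi" using assms d by (auto simp: darts_def)
  have s': "- s = 1 \<or> - s = - 1" using s by auto
  \<comment> \<open>Looking back from the far end, the first vertex is the one just left; a nearer
    one would lie inside the edge.\<close>
  have "stp p (\<theta> + s * ?x) (- s) = ?x"
    unfolding stp_def[of p "\<theta> + s * ?x" "- s"]
  proof (rule Min_eqI)
    show "finite {x. 0 < x \<and> x \<le> pi \<and> \<theta> + s * ?x + - s * x \<in> ev p}" using finite_steps[OF s'] .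
    show "?x \<in> {x. 0 < x \<and> x \<le> pi \<and> \<theta> + s * ?x + - s * x \<in> ev p}"
      using stp_pos[OF s] stp_le[OF s] \<theta> by auto
    fix y assume y: "y \<in> {x. 0 < x \<and> x \<le> pi \<and> \<theta> + s * ?x + - s * x \<in> ev p}"
    show "?x \<le> y"
    proof (rule ccontr)
      assume "\<not> ?x \<le> y"
      then have "\<theta> + s * (?x - y) \<notin> ev p" using y by (intro stp_least[OF s]) auto
      then show False using y by (simp add: algebra_simps)
    qed
  qed
  then show ?thesis using d wrap_wrap_add[of "\<theta> + s * ?x" "- (s * ?x)"] wrap_id[OF \<theta>(2,3)] by simp
qed

lemma tc_inj_blk: "q \<in> blk p \<theta> \<Longrightarrow> r \<in> blk p \<theta> \<Longrightarrow> tc \<theta> q = tc \<theta> r \<Longrightarrow> q = r"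
  using hc_tc_eqI[of \<theta> q r] by (simp add: blk_def)

text \<open>The derivative of \<open>hc \<theta> p\<close> in \<open>\<theta>\<close> is
  \<open>- tc \<theta> p\<close>, so increasing \<open>tc\<close> lists the darts with
  \<open>s = 1\<close> at a vertex from top to bottom and those with \<open>s = - 1\<close> from
  bottom to top. Hence \<open>rho\<close> turns clockwise. This is the case that stays on one side
  of the vertex; \<open>rho_turn\<close> is the case that changes sides.\<close>

lemma rho_next:
  assumes "\<exists>q\<in>blk p \<theta>. tc \<theta> p < tc \<theta> q"
  obtains p' where "rho (p, \<theta>, s) = (p', \<theta>, s)" "p' \<in> blk p \<theta>" "tc \<theta> p < tc \<theta> p'"
    "\<And>q. q \<in> blk p \<theta> \<Longrightarrow> tc \<theta> p < tc \<theta> q \<Longrightarrow> tc \<theta> p' \<le> tc \<theta> q"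
proof -
  let ?A = "{q\<in>blk p \<theta>. tc \<theta> p < tc \<theta> q}"
  have A: "finite ?A" "?A \<noteq> {}" using assms by auto
  show ?thesis
  proof (rule that)
    show "rho (p, \<theta>, s) = (arg_min_on (tc \<theta>) ?A, \<theta>, s)" using assms by (simp add: rho.simps)
    show "arg_min_on (tc \<theta>) ?A \<in> blk p \<theta>" "tc \<theta> p < tc \<theta> (arg_min_on (tc \<theta>) ?A)"
      using arg_min_if_finite(1)[OF A, of "tc \<theta>"] by auto
    show "tc \<theta> (arg_min_on (tc \<theta>) ?A) \<le> tc \<theta> q" if "q \<in> blk p \<theta>" "tc \<theta> p < tc \<theta> q" for q
      using arg_min_least[OF A, of q] that by auto
  qed
qed

lemma rho_turn:
  assumes "\<not> (\<exists>q\<in>blk p \<theta>. tc \<theta> p < tc \<theta> q)" "p \<in> P"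
  obtains p' where "rho (p, \<theta>, s) = (p', \<theta>, - s)" "p' \<in> blk p \<theta>"
    "\<And>q. q \<in> blk p \<theta> \<Longrightarrow> tc \<theta> p' \<le> tc \<theta> q"
proof -
  have A: "finite (blk p \<theta>)" "blk p \<theta> \<noteq> {}" using blk_self[of p \<theta>] assms by auto
  show ?thesis
  proof (rule that)
    show "rho (p, \<theta>, s) = (arg_min_on (tc \<theta>) (blk p \<theta>), \<theta>, - s)" using assms by (simp add: rho.simps)
    show "arg_min_on (tc \<theta>) (blk p \<theta>) \<in> blk p \<theta>"
      using arg_min_if_finite(1)[OF A, of "tc \<theta>"] by auto
    show "tc \<theta> (arg_min_on (tc \<theta>) (blk p \<theta>)) \<le> tc \<theta> q" if "q \<in> blk p \<theta>" for q
      using arg_min_least[OF A that] .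
  qed
qed

lemma rho_cases:
  assumes "p \<in> P"
  obtains (nxt) p' where "rho (p, \<theta>, s) = (p', \<theta>, s)" "p' \<in> blk p \<theta>" "tc \<theta> p < tc \<theta> p'"
    "\<And>q. q \<in> blk p \<theta> \<Longrightarrow> tc \<theta> p < tc \<theta> q \<Longrightarrow> tc \<theta> p' \<le> tc \<theta> q"
  | (turn) p' where "rho (p, \<theta>, s) = (p', \<theta>, - s)" "p' \<in> blk p \<theta>"
    "\<And>q. q \<in> blk p \<theta> \<Longrightarrow> tc \<theta> p' \<le> tc \<theta> q" "\<And>q. q \<in> blk p \<theta> \<Longrightarrow> tc \<theta> q \<le> tc \<theta> p"
  using rho_next[of p \<theta> s] rho_turn[of p \<theta> s] assms by (metis linorder_not_less)

lemma rho_in: 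
  assumes "d \<in> darts"
  shows "rho d \<in> darts" "mult (rho d) = mult d" "fst (rho d) \<noteq> fst d" "fst (rho d) \<in> blk (fst d) (fst (snd d))"
    "fst (snd (rho d)) = fst (snd d)"
proof -
  obtain p \<theta> s where d: "d = (p, \<theta>, s)" using prod_cases3 .
  have p: "p \<in> P" "\<theta> \<in> ev p" and r: "0 \<le> \<theta>" "\<theta> < 2 * pi" "s = 1 \<or> s = - 1"
    using assms d by (auto simp: darts_def)
  obtain q where q: "q \<in> blk p \<theta>" "q \<noteq> p" using p by (auto simp: ev_def blk_def)
  have *: "\<exists>p' s'. rho (p, \<theta>, s) = (p', \<theta>, s') \<and> (s' = 1 \<or> s' = - 1) \<and> p' \<in> blk p \<theta> \<and> p' \<noteq> p"
    using p(1)
  proof (cases rule: rho_cases[where \<theta> = \<theta> and s = s])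
    case (nxt p') then show ?thesis using r by auto
  next
    case (turn p')
    have "p' \<noteq> p"
    proof
      assume "p' = p"
      then have "tc \<theta> q = tc \<theta> p" using turn(3,4)[OF q(1)] by simp
      then show False using tc_inj_blk[OF q(1) blk_self] p q by blast
    qed
    then show ?thesis using turn r by auto
  qed
  then obtain p' s' where 1: "rho (p, \<theta>, s) = (p', \<theta>, s')" "s' = 1 \<or> s' = - 1" "p' \<in> blk p \<theta>" "p' \<noteq> p"
    by blast
  have "p' \<in> P" "blk p' \<theta> = blk p \<theta>" using 1 blk_eq by (auto simp: blk_def)
  moreover then have "\<theta> \<in> ev p'" using card_blk_ge_2_iff p by metis
  ultimately show "rho d \<in> darts" "mult (rho d) = mult d" "fst (rho d) \<noteq> fst d" "fst (rho d) \<in> blk (fst d) (fst (snd d))"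
    "fst (snd (rho d)) = fst (snd d)"
    using 1 d r by (simp_all add: darts_def)
qed

text \<open>The image shows the case, since only a turn ends at the least \<open>tc\<close> of the
  block. In a turn the source has the greatest \<open>tc\<close>, otherwise the next smaller
  one.\<close>

lemma inj_rho: "inj_on rho darts"
proof (rule inj_onI)
  fix d e assume de: "d \<in> darts" "e \<in> darts" "rho d = rho e"
  obtain p \<theta> s where d: "d = (p, \<theta>, s)" using prod_cases3 .
  obtain q \<eta> u where e: "e = (q, \<eta>, u)" using prod_cases3 .
  have \<eta>: "\<eta> = \<theta>" using rho_in(5)[of d] rho_in(5)[of e] de d e by simp
  have su: "s = 1 \<or> s = - 1" "u = 1 \<or> u = - 1" and pq: "p \<in> P" "q \<in> P" using de d e by (auto simp: darts_def)
  have b: "blk p \<theta> = blk q \<theta>"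
    using rho_in(4)[of d] rho_in(4)[of e] de d e \<eta> blk_eq by simp metis
  have pb: "p \<in> blk q \<theta>" "q \<in> blk q \<theta>" using blk_self pq b by metis+
  have tri: "p = q \<or> tc \<theta> p < tc \<theta> q \<or> tc \<theta> q < tc \<theta> p"
    using tc_inj_blk[OF pb] by linarith
  have "p = q \<and> s = u"
    using pq(1)
  proof (cases rule: rho_cases[where \<theta> = \<theta> and s = s])
    case p: (nxt p1)
    show ?thesis using pq(2)
    proof (cases rule: rho_cases[where \<theta> = \<theta> and s = u])
      case q: (nxt q1)
      have "p1 = q1" "s = u" using p(1) q(1) de(3) d e \<eta> by auto
      then show ?thesis using p(3) q(3) p(4)[of q] q(4)[of p] b pb tri by force
    next
      case q: (turn q1)
      have "p1 = q1" using p(1) q(1) de(3) d e \<eta> by auto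
      then show ?thesis using p(3) q(3)[of p] pb by force
    qed
  next
    case p: (turn p1)
    show ?thesis using pq(2)
    proof (cases rule: rho_cases[where \<theta> = \<theta> and s = u])
      case q: (nxt q1)
      have "p1 = q1" using p(1) q(1) de(3) d e \<eta> by auto
      then show ?thesis using q(3) p(3)[of q] b pb by force
    next
      case q: (turn q1)
      have "p1 = q1" "s = u" using p(1) q(1) de(3) d e \<eta> by auto
      then show ?thesis using p(4)[of q] q(4)[of p] b pb tri by force
    qed
  qed
  then show "d = e" using d e \<eta> by simp
qed

lemma phi_permutes: "phi permutes darts"
proof (rule bij_imp_permutes)
  have "inj_on phi darts"
  proof (rule inj_onI)
    fix d e assume de: "d \<in> darts" "e \<in> darts" "phi d = phi e"
    then have "alp d = alp e" using inj_onD[OF inj_rho] alp_in by (simp add: phi_def)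
    then show "d = e" using alp_alp de by metis
  qed
  moreover have "phi ` darts \<subseteq> darts" using rho_in(1)[OF alp_in] by (auto simp: phi_def simp del: alp.simps)
  ultimately show "bij_betw phi darts darts"
    using finite_darts by (metis bij_betw_def card_image card_subset_eq)
  show "phi d = d" if "d \<notin> darts" for d using that by (simp add: phi_def)
qed

lemma permutation_phi: "permutation phi"
  using phi_permutes finite_darts permutation_permutes by blast

lemma phi_in: "d \<in> darts \<Longrightarrow> phi d \<in> darts"
  using permutes_in_image[OF phi_permutes] by blast

lemma phi_point: 
  assumes "d \<in> darts" shows "fst (phi d) \<noteq> fst d" 
proof -
  have "fst (alp d) = fst d" by (cases d) auto
  then show ?thesis using rho_in(3)[OF alp_in[OF assms]] assms by (simp add: phi_def)
qed

text \<open>The order of the points along the normal changes only at events.\<close>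
lemma below_step:
  assumes "s = 1 \<or> s = - 1" "p \<in> P" and \<eta>: "\<eta> = \<theta> + s * stp p \<theta> s"
  shows "below (p, \<theta>, s) = {q\<in>P. s * hc \<eta> q < s * hc \<eta> p \<or> hc \<eta> q = hc \<eta> p \<and> tc \<eta> q \<le> tc \<eta> p}"
proof -
  let ?d = "stp p \<theta> s"
  \<comment> \<open>The height of \<open>q - p\<close> is a sinusoid that vanishes only at events of
    \<open>p\<close>, so \<open>sinusoid_sign\<close> carries its sign from just after
    \<open>\<theta>\<close> to just before \<open>\<eta>\<close>.\<close>
  have dir: "s * hc \<eta> v < 0 \<or> hc \<eta> v = 0 \<and> tc \<eta> v < 0"
    if neg: "s * hc \<theta> v < 0 \<or> hc \<theta> v = 0 \<and> 0 < tc \<theta> v" and q: "q \<in> P" "q \<noteq> p" and v: "v = q - p \<or> v = p - q" for q v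
  proof -
    define a b where "a = s * hc \<theta> v" and "b = tc \<theta> v"
    have h: "s * hc (\<theta> + s * x) v = a * cos x - b * sin x" for x
      using assms(1) by (auto simp: hc_add_angle a_def b_def)
    have t: "tc (\<theta> + s * x) v = b * cos x + a * sin x" for x
      using assms(1) by (auto simp: tc_add_angle a_def b_def)
    have "a * cos x - b * sin x \<noteq> 0" if "0 < x" "x < ?d" for x
    proof
      assume "a * cos x - b * sin x = 0"
      then have "hc (\<theta> + s * x) v = 0" using h[of x] assms(1) by auto
      then have "\<theta> + s * x \<in> ev p" using q v by (auto simp: ev_def hc_diff)
      then show False using stp_least[OF assms(1) that] by blast
    qed
    then have "a * cos ?d - b * sin ?d < 0 \<or> a * cos ?d - b * sin ?d = 0 \<and> b * cos ?d + a * sin ?d < 0"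
      using neg assms(1) stp_pos[OF assms(1)] stp_le[OF assms(1)]
      by (intro sinusoid_sign) (auto simp: a_def b_def)
    then show ?thesis using h[of ?d] t[of ?d] \<eta> assms(1) by auto
  qed
  have "(s * hc \<theta> q < s * hc \<theta> p \<or> hc \<theta> q = hc \<theta> p \<and> tc \<theta> p \<le> tc \<theta> q) \<longleftrightarrow>
      (s * hc \<eta> q < s * hc \<eta> p \<or> hc \<eta> q = hc \<eta> p \<and> tc \<eta> q \<le> tc \<eta> p)" if q: "q \<in> P" "q \<noteq> p" for q
  proof -
    have ne: "hc \<theta> q = hc \<theta> p \<Longrightarrow> tc \<theta> q \<noteq> tc \<theta> p" using hc_tc_eqI q by blast
    have 1: "s * hc \<theta> q < s * hc \<theta> p \<or> hc \<theta> q = hc \<theta> p \<and> tc \<theta> p < tc \<theta> q \<Longrightarrow>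
      s * hc \<eta> q < s * hc \<eta> p \<or> hc \<eta> q = hc \<eta> p \<and> tc \<eta> q < tc \<eta> p"
      using dir[of "q - p" q] q by (simp add: hc_diff tc_diff right_diff_distrib)
    have 2: "s * hc \<theta> p < s * hc \<theta> q \<or> hc \<theta> q = hc \<theta> p \<and> tc \<theta> q < tc \<theta> p \<Longrightarrow>
      s * hc \<eta> p < s * hc \<eta> q \<or> hc \<eta> q = hc \<eta> p \<and> tc \<eta> p < tc \<eta> q"
      using dir[of "p - q" q] q by (auto simp: hc_diff tc_diff right_diff_distrib)
    show ?thesis
    proof
      assume "s * hc \<theta> q < s * hc \<theta> p \<or> hc \<theta> q = hc \<theta> p \<and> tc \<theta> p \<le> tc \<theta> q"
      then have "s * hc \<theta> q < s * hc \<theta> p \<or> hc \<theta> q = hc \<theta> p \<and> tc \<theta> p < tc \<theta> q" using ne by linarith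
      from 1[OF this] show "s * hc \<eta> q < s * hc \<eta> p \<or> hc \<eta> q = hc \<eta> p \<and> tc \<eta> q \<le> tc \<eta> p" by linarith
    next
      assume B: "s * hc \<eta> q < s * hc \<eta> p \<or> hc \<eta> q = hc \<eta> p \<and> tc \<eta> q \<le> tc \<eta> p"
      show "s * hc \<theta> q < s * hc \<theta> p \<or> hc \<theta> q = hc \<theta> p \<and> tc \<theta> p \<le> tc \<theta> q"
      proof (rule ccontr)
        assume "\<not> ?thesis"
        then have "s * hc \<theta> p < s * hc \<theta> q \<or> hc \<theta> q = hc \<theta> p \<and> tc \<theta> q < tc \<theta> p"
          using assms(1) by force
        from 2[OF this] show False using B by auto
      qed
    qed
  qed
  then show ?thesis by (auto split: if_splits)
qed

text \<open>At the far end, points on the common line are near if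
  \<open>tc \<eta> q \<le> tc \<eta> p\<close>. Passing to the next point reverses the sign and
  takes exactly the other points, so \<open>below\<close> becomes its complement, which
  \<open>face\<close> undoes. In a turn \<open>p\<close> is last and \<open>p'\<close> first, so the
  whole common line is near before and after.\<close>

lemma face_phi:
  assumes "d \<in> darts" shows "face (phi d) = face d"
proof -
  obtain p \<theta> s where d: "d = (p, \<theta>, s)" using prod_cases3 .
  have p: "p \<in> P" and s: "s = 1 \<or> s = - 1" using assms d by (auto simp: darts_def)
  define \<eta> where "\<eta> = wrap (\<theta> + s * stp p \<theta> s)"
  have B: "below d = {q\<in>P. s * hc \<eta> q < s * hc \<eta> p \<or> hc \<eta> q = hc \<eta> p \<and> tc \<eta> q \<le> tc \<eta> p}"
    unfolding d using below_step[OF s p refl] by (simp add: \<eta>_def)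
  have f: "phi d = rho (p, \<eta>, - s)" using assms d by (simp add: phi_def \<eta>_def)
  show ?thesis using p
  proof (cases rule: rho_cases[where \<theta> = \<eta> and s = "- s"])
    case (nxt p')
    have h: "hc \<eta> p' = hc \<eta> p" using nxt by (auto simp: blk_def)
    have "tc \<eta> p' \<le> tc \<eta> q \<longleftrightarrow> tc \<eta> p < tc \<eta> q" if "q \<in> P" "hc \<eta> q = hc \<eta> p" for q
      using nxt(3) nxt(4)[of q] that by (auto simp: blk_def)
    then have "below (p', \<eta>, - s) = P - below d" 
      unfolding B using h s by (auto simp: not_le)
    moreover have "below d \<subseteq> P" unfolding B by blast
    ultimately show ?thesis using f nxt(1) d s by (auto simp del: below.simps)
  next
    case (turn p')
    have h: "hc \<eta> p' = hc \<eta> p" using turn by (auto simp: blk_def)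
    have "below (p', \<eta>, s) = below d"
      unfolding B using h s turn by (auto simp: blk_def)
    then show ?thesis using f turn(1) d by (cases "s = 1") (simp_all del: below.simps)
  qed
qed

section \<open>Euler's formula\<close>

fun low :: "dart \<Rightarrow> bool" where
  "low (p, \<theta>, s) \<longleftrightarrow> (\<forall>q\<in>blk p \<theta>. tc \<theta> p \<le> tc \<theta> q)"

lemma ex_low:
  assumes "p \<in> P" obtains p' where "p' \<in> blk p \<theta>" "\<And>q. q \<in> blk p \<theta> \<Longrightarrow> tc \<theta> p' \<le> tc \<theta> q"
  using arg_min_if_finite(1)[of "blk p \<theta>" "tc \<theta>"] arg_min_least[of "blk p \<theta>" _ "tc \<theta>"]
    blk_self[OF assms, of \<theta>] finite_blk by blast

text \<open>Each of the two sides of a vertex of multiplicity k has k darts, exactly one of them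
  low. So both sums are twice the number of vertices; \<open>lo\<close> moves a dart to the low one
  on its side.\<close>

lemma card_low: "real (card {d\<in>darts. low d}) = (\<Sum>d\<in>darts. 1 / real (mult d))"
proof -
  define lo :: "dart \<Rightarrow> dart"
    where "lo = (\<lambda>d. (SOME p'. p' \<in> blk (fst d) (fst (snd d)) \<and> (\<forall>q\<in>blk (fst d) (fst (snd d)). tc (fst (snd d)) p' \<le> tc (fst (snd d)) q), snd d))"
  let ?L = "{d\<in>darts. low d}"
  have lo: "\<exists>p'. lo (p, \<theta>, s) = (p', \<theta>, s) \<and> p' \<in> blk p \<theta> \<and> (\<forall>q\<in>blk p \<theta>. tc \<theta> p' \<le> tc \<theta> q)" 
    if "p \<in> P" for p \<theta> s
  proof -
    have "\<exists>p'. p' \<in> blk p \<theta> \<and> (\<forall>q\<in>blk p \<theta>. tc \<theta> p' \<le> tc \<theta> q)"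
      using ex_low[OF that, of \<theta>] by metis
    from someI_ex[OF this] show ?thesis by (simp add: lo_def)
  qed
  have in_darts: "(q, \<theta>, s) \<in> darts" if "(p, \<theta>, s) \<in> darts" "q \<in> blk p \<theta>" for p q \<theta> s
  proof -
    have pP: "p \<in> P" "q \<in> P" using that by (auto simp: darts_def blk_def)
    have "\<theta> \<in> ev q"
      using card_blk_ge_2_iff[OF pP(1), of \<theta>] card_blk_ge_2_iff[OF pP(2), of \<theta>] blk_eq[OF that(2)] that(1)
      by (simp add: darts_def)
    then show ?thesis using that pP by (simp add: darts_def)
  qed
  have sub: "lo ` darts \<subseteq> ?L"
  proof
    fix e assume "e \<in> lo ` darts"
    then obtain p \<theta> s where d: "(p, \<theta>, s) \<in> darts" "e = lo (p, \<theta>, s)" by auto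
    then have "p \<in> P" by (simp add: darts_def)
    then obtain p' where p': "e = (p', \<theta>, s)" "p' \<in> blk p \<theta>" "\<forall>q\<in>blk p \<theta>. tc \<theta> p' \<le> tc \<theta> q"
      using lo d by metis
    then show "e \<in> ?L" using in_darts d(1) blk_eq[OF p'(2)] by simp
  qed
  have fib: "(\<Sum>d\<in>{d\<in>darts. lo d = l}. 1 / real (mult d)) = 1" if "l \<in> ?L" for l
  proof -
    obtain p \<theta> s where l: "l = (p, \<theta>, s)" using prod_cases3 .
    have pl: "(p, \<theta>, s) \<in> darts" "low (p, \<theta>, s)" "p \<in> P" using that l by (auto simp: darts_def)
    have "{d\<in>darts. lo d = l} = (\<lambda>q. (q, \<theta>, s)) ` blk p \<theta>"
    proof (intro equalityI subsetI)
      fix d assume d: "d \<in> {d\<in>darts. lo d = l}"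
      obtain q \<eta> u where q: "d = (q, \<eta>, u)" using prod_cases3 .
      have qP: "q \<in> P" using d q by (simp add: darts_def)
      have "\<eta> = \<theta>" "u = s" "p \<in> blk q \<eta>" using lo[OF qP, of \<eta> u] d q l by auto
      then show "d \<in> (\<lambda>q. (q, \<theta>, s)) ` blk p \<theta>" using q blk_eq blk_self[OF qP] by blast
    next
      fix d assume "d \<in> (\<lambda>q. (q, \<theta>, s)) ` blk p \<theta>"
      then obtain q where q: "q \<in> blk p \<theta>" "d = (q, \<theta>, s)" by blast
      have qP: "q \<in> P" using q by (simp add: blk_def)
      have b: "blk q \<theta> = blk p \<theta>" using blk_eq[OF q(1)] .
      obtain p' where p': "lo (q, \<theta>, s) = (p', \<theta>, s)" "p' \<in> blk p \<theta>" "\<forall>q\<in>blk p \<theta>. tc \<theta> p' \<le> tc \<theta> q"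
        using lo[OF qP, of \<theta> s] b by auto
      have "tc \<theta> p' \<le> tc \<theta> p" "tc \<theta> p \<le> tc \<theta> p'" using p' pl blk_self[OF pl(3)] by auto
      then have "p' = p" using tc_inj_blk[OF p'(2) blk_self[OF pl(3)]] by simp
      then show "d \<in> {d\<in>darts. lo d = l}" using q p' l in_darts[OF pl(1) q(1)] by simp
    qed
    moreover have "inj_on (\<lambda>q. (q, \<theta>, s)) (blk p \<theta>)" by (auto intro: inj_onI)
    ultimately have "(\<Sum>d\<in>{d\<in>darts. lo d = l}. 1 / real (mult d)) = (\<Sum>q\<in>blk p \<theta>. 1 / real (card (blk q \<theta>)))"
      by (simp add: sum.reindex)
    also have "\<dots> = (\<Sum>q\<in>blk p \<theta>. 1 / real (card (blk p \<theta>)))"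
      using blk_eq by (intro sum.cong) auto
    also have "\<dots> = 1" using blk_self[OF pl(3), of \<theta>] by (auto simp: card_gt_0_iff)
    finally show ?thesis .
  qed
  have "(\<Sum>d\<in>darts. 1 / real (mult d)) = (\<Sum>l\<in>?L. \<Sum>d\<in>{d\<in>darts. lo d = l}. 1 / real (mult d))"
    using finite_darts sub by (intro sum.group[symmetric]) auto
  then show ?thesis using fib by simp
qed

text \<open>If two different angles were the left end of the same face, then each of the two pairs of lines that
  meet there would have to cross strictly before the other one.\<close>
lemma turning_dart_unique:
  assumes "(p, \<theta>, s) \<in> darts" "(q, \<eta>, s) \<in> darts" "\<not> low (p, \<theta>, s)" "\<not> low (q, \<eta>, s)"
    and eq: "below (p, \<theta>, s) = below (q, \<eta>, s)"
  shows "(p, \<theta>, s) = (q, \<eta>, s)"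
proof -
  have s: "s = 1 \<or> s = - 1" and \<theta>: "0 \<le> \<theta>" "\<theta> < 2 * pi" and \<eta>: "0 \<le> \<eta>" "\<eta> < 2 * pi"
    and P: "p \<in> P" "q \<in> P" using assms by (auto simp: darts_def)
  \<comment> \<open>The curves of \<open>a\<close> and \<open>c\<close> cross at
    \<open>\<alpha>\<close>, and \<open>a\<close> is on the near side for half a turn after that.
    The common set separates \<open>a\<close> from \<open>c\<close> at \<open>\<beta>\<close> too,
    so \<open>\<beta>\<close> lies in this half turn or is \<open>\<alpha>\<close> up to full
    turns.\<close>
  have key: "s * sin (\<beta> - \<alpha>) > 0 \<or> sin (\<beta> - \<alpha>) = 0 \<and> cos (\<beta> - \<alpha>) > 0"
    if nl: "\<not> low (a, \<alpha>, s)" and ab: "below (a, \<alpha>, s) = below (b, \<beta>, s)" and aP: "a \<in> P" for a b \<alpha> \<beta>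
  proof -
    obtain c where c: "c \<in> P" "hc \<alpha> c = hc \<alpha> a" "tc \<alpha> c < tc \<alpha> a" using nl by (auto simp: blk_def not_le)
    have "a \<in> below (a, \<alpha>, s)" "c \<notin> below (a, \<alpha>, s)" using c aP by auto
    then have "a \<in> below (b, \<beta>, s)" "c \<notin> below (b, \<beta>, s)" using ab by auto
    then have "s * hc \<beta> a < s * hc \<beta> c \<or> hc \<beta> a = hc \<beta> c \<and> tc \<beta> c < tc \<beta> a"
      using c aP s by auto
    then have 1: "s * hc \<beta> (a - c) < 0 \<or> hc \<beta> (a - c) = 0 \<and> 0 < tc \<beta> (a - c)"
      by (auto simp: hc_diff tc_diff right_diff_distrib)
    define A where "A = tc \<alpha> (a - c)"
    have A: "A > 0" "hc \<alpha> (a - c) = 0" using c by (simp_all add: A_def hc_diff tc_diff)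
    have "hc \<beta> (a - c) = - A * sin (\<beta> - \<alpha>)" "tc \<beta> (a - c) = A * cos (\<beta> - \<alpha>)"
      using hc_add_angle[of \<alpha> "\<beta> - \<alpha>" "a - c"] tc_add_angle[of \<alpha> "\<beta> - \<alpha>" "a - c"] A by (simp_all add: A_def)
    then show ?thesis using 1 A s by (auto simp: zero_less_mult_iff mult_less_0_iff)
  qed
  have 1: "s * sin (\<eta> - \<theta>) > 0 \<or> sin (\<eta> - \<theta>) = 0 \<and> cos (\<eta> - \<theta>) > 0"
    using key[OF assms(3) eq P(1)] .
  have 2: "s * sin (\<theta> - \<eta>) > 0 \<or> sin (\<theta> - \<eta>) = 0 \<and> cos (\<theta> - \<eta>) > 0"
    using key[OF assms(4) eq[symmetric] P(2)] .
  have "sin (\<theta> - \<eta>) = - sin (\<eta> - \<theta>)" using sin_minus[of "\<eta> - \<theta>"] by simp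
  then have sc: "sin (\<eta> - \<theta>) = 0" "cos (\<eta> - \<theta>) > 0" using 1 2 by auto
  then obtain n :: int where n: "\<eta> - \<theta> = of_int n * pi" using sin_zero_iff_int2 by blast
  have "\<bar>of_int n * pi\<bar> < 2 * pi" using n \<theta> \<eta> by linarith
  then have "\<bar>of_int n :: real\<bar> < 2" by (simp add: abs_mult)
  then have "n = 0 \<or> n = 1 \<or> n = - 1" by linarith
  then have eqa: "\<eta> = \<theta>" using n sc by auto
  have "p \<in> below (p, \<theta>, s)" "q \<in> below (q, \<theta>, s)" using P by auto
  then have "p \<in> below (q, \<theta>, s)" "q \<in> below (p, \<theta>, s)" using eq eqa by auto
  then have "hc \<theta> p = hc \<theta> q" "tc \<theta> p = tc \<theta> q" using s by auto
  then show ?thesis using hc_tc_eqI eqa by blast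
qed

lemma face_orbit:
  assumes "d \<in> darts" "e \<in> orbit phi d" shows "face e = face d"
proof -
  have "e \<in> darts \<and> face e = face d" using assms(2)
    by (induction) (use assms(1) face_phi phi_in in auto)
  then show ?thesis by simp
qed

text \<open>This is the face above all curves. Direction 0 need not be a vertex, so the highest
  curve there is followed to its next event, and the curve that is highest after that vertex gives
  the dart.\<close>

lemma ex_outer_dart: obtains d where "d \<in> darts" "face d = P"
proof -
  obtain a where "a \<in> P" using ex_other by blast
  then have "finite (hc 0 ` P)" "hc 0 ` P \<noteq> {}" using finite_P by auto
  then obtain b where b: "b \<in> P" "\<And>q. q \<in> P \<Longrightarrow> hc 0 q \<le> hc 0 b"
    by (metis (no_types, lifting) Max_ge Max_in imageE imageI)
  obtain c where c: "c \<in> blk b 0" "\<And>q. q \<in> blk b 0 \<Longrightarrow> tc 0 c \<le> tc 0 q" using ex_low[OF b(1)] by blast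
  have cP: "c \<in> P" "hc 0 c = hc 0 b" using c by (auto simp: blk_def)
  define \<eta> where "\<eta> = 0 + 1 * stp c 0 1"
  have "below (c, 0, 1) = P" using b c cP by (auto simp: blk_def order.order_iff_strict)
  then have top: "hc \<eta> q < hc \<eta> c \<or> hc \<eta> q = hc \<eta> c \<and> tc \<eta> q \<le> tc \<eta> c" if "q \<in> P" for q
    using below_step[OF _ cP(1) \<eta>_def] that by auto
  obtain e where e: "e \<in> blk c \<eta>" "\<And>q. q \<in> blk c \<eta> \<Longrightarrow> tc \<eta> e \<le> tc \<eta> q" using ex_low[OF cP(1)] by blast
  have eP: "e \<in> P" "hc \<eta> e = hc \<eta> c" using e by (auto simp: blk_def)
  have "\<eta> \<in> ev c" unfolding \<eta>_def by (rule stp_ev) simp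
  then have "\<eta> \<in> ev e" using card_blk_ge_2_iff[OF cP(1), of \<eta>] card_blk_ge_2_iff[OF eP(1), of \<eta>] blk_eq[OF e(1)] by simp
  then have "(e, wrap \<eta>, 1) \<in> darts" using eP wrap_range by (simp add: darts_def)
  moreover have "below (e, wrap \<eta>, 1) = P" using top e eP by (auto simp: blk_def)
  ultimately show ?thesis using that[of "(e, wrap \<eta>, 1)"] by (simp del: below.simps)
qed

text \<open>Darts of one face with the same sign have the same \<open>below\<close>, so each face
  has at most one that is not low. The outer face has none: a dart that is not low separates its own
  point from another one on the line, so its \<open>below\<close> is neither empty nor
  \<open>P\<close>.\<close>

lemma card_turning:
  assumes s: "s = 1 \<or> s = - 1"
  shows "card {d\<in>darts. \<not> low d \<and> snd (snd d) = s} < card (orbit phi ` darts)"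
proof -
  let ?F = "{d\<in>darts. \<not> low d \<and> snd (snd d) = s}"
  obtain o1 where o1: "o1 \<in> darts" "face o1 = P" using ex_outer_dart .
  have below: "below d = (if s = 1 then face d else P - face d)" if "d \<in> ?F" for d
    using that s by (cases d) auto
  have "inj_on (orbit phi) ?F"
  proof (rule inj_onI)
    fix d e assume d: "d \<in> ?F" and e: "e \<in> ?F" and de: "orbit phi d = orbit phi e"
    have "d \<in> orbit phi e" using permutation_self_in_orbit[OF permutation_phi] de by metis
    then have "face d = face e" using face_orbit e by blast
    then have "below d = below e" using below d e by simp
    moreover obtain p \<theta> where "d = (p, \<theta>, s)" using d by (cases d) auto
    moreover obtain q \<eta> where "e = (q, \<eta>, s)" using e by (cases e) auto
    ultimately show "d = e" using turning_dart_unique[of p \<theta> s q \<eta>] d e by blast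
  qed
  moreover have "orbit phi ` ?F \<subseteq> orbit phi ` darts - {orbit phi o1}"
  proof
    fix C assume "C \<in> orbit phi ` ?F"
    then obtain d where d: "d \<in> ?F" "C = orbit phi d" by blast
    have "C \<noteq> orbit phi o1"
    proof
      assume "C = orbit phi o1"
      then have "d \<in> orbit phi o1" using permutation_self_in_orbit[OF permutation_phi] d by metis
      then have "face d = P" using face_orbit o1 by blast
      then have B: "below d = P \<or> below d = {}" using below[OF d(1)] by auto
      obtain p \<theta> where p: "d = (p, \<theta>, s)" using d by (cases d) auto
      have "p \<in> P" using d p by (simp add: darts_def)
      then have "p \<in> below d" using p by simp
      moreover obtain q where "q \<in> P" "hc \<theta> q = hc \<theta> p" "tc \<theta> q < tc \<theta> p"
        using d p by (auto simp: blk_def not_le)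
      moreover then have "q \<notin> below d" using p by simp
      ultimately show False using B by blast
    qed
    then show "C \<in> orbit phi ` darts - {orbit phi o1}" using d by blast
  qed
  ultimately have "card ?F \<le> card (orbit phi ` darts - {orbit phi o1})"
    using finite_darts by (intro card_inj_on_le) auto
  also have "\<dots> < card (orbit phi ` darts)" using finite_darts o1(1) by (intro card_Diff1_less) auto
  finally show ?thesis .
qed

abbreviation flen :: "dart \<Rightarrow> nat" where
  "flen d \<equiv> card (orbit phi d)"

text \<open>Euler's formula. The sign of a dart changes along a face exactly at the darts that are not
  \<open>low\<close>, that is twice per face, except on the two faces with no leftmost point.\<close>
lemma euler: "0 < (\<Sum>d\<in>darts. 2 / real (flen d) + 1 / real (mult d) - 1)"
proof -
  let ?F = "\<lambda>s. {d\<in>darts. \<not> low d \<and> snd (snd d) = s}"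
  have "darts = {d\<in>darts. low d} \<union> (?F 1 \<union> ?F (- 1))" by (auto simp: darts_def)
  then have "card darts = card ({d\<in>darts. low d} \<union> (?F 1 \<union> ?F (- 1)))" by simp
  also have "\<dots> \<le> card {d\<in>darts. low d} + (card (?F 1) + card (?F (- 1)))"
    using card_Un_le by (meson add_left_mono order_trans)
  also have "\<dots> < card {d\<in>darts. low d} + (card (orbit phi ` darts) + card (orbit phi ` darts))"
    using card_turning[of 1] card_turning[of "- 1"] by simp
  \<comment> \<open>With V vertices, E edges and F faces this reads 2E < 2V + 2F.\<close>
  finally have "real (card darts) < real (card {d\<in>darts. low d}) + 2 * real (card (orbit phi ` darts))"
    by linarith
  moreover have "(\<Sum>d\<in>darts. 2 / real (flen d)) = 2 * (\<Sum>d\<in>darts. 1 / real (flen d))"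
    by (simp add: sum_distrib_left)
  ultimately show ?thesis
    using sum_inverse_card_orbit[OF phi_permutes finite_darts] card_low
    by (simp add: sum.distrib sum_subtractf)
qed

section \<open>Short faces and the Sylvester--Gallai theorem\<close>

lemma apart_step:
  assumes "s = 1 \<or> s = - 1" "p \<in> P" "q \<noteq> p" "hc \<theta> q = hc \<theta> p"
  shows "hc (\<theta> + s * stp p \<theta> s) q \<noteq> hc (\<theta> + s * stp p \<theta> s) p"
proof
  assume "hc (\<theta> + s * stp p \<theta> s) q = hc (\<theta> + s * stp p \<theta> s) p"
  \<comment> \<open>Two curves meet again only after a multiple of pi, but an edge is shorter than
    pi.\<close>
  then have "sin (s * stp p \<theta> s) = 0" using sin_eq_0_if_hc assms by blast
  then have "sin (stp p \<theta> s) = 0" using assms(1) by auto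
  then show False using sin_gt_zero[OF stp_pos[OF assms(1)] stp_less_pi[OF assms(1,2)]] by (metis less_irrefl)
qed

lemma phi_cases:
  assumes "(p, \<theta>, s) \<in> darts"
  obtains q u where "phi (p, \<theta>, s) = (q, wrap (\<theta> + s * stp p \<theta> s), u)" "q \<in> P" "q \<noteq> p"
    "hc (\<theta> + s * stp p \<theta> s) q = hc (\<theta> + s * stp p \<theta> s) p"
    "mult (q, wrap (\<theta> + s * stp p \<theta> s), u) = card (blk p (\<theta> + s * stp p \<theta> s))"
proof -
  have a: "alp (p, \<theta>, s) \<in> darts" using alp_in assms by blast
  obtain q \<eta> u where q: "phi (p, \<theta>, s) = (q, \<eta>, u)" using prod_cases3 .
  show ?thesis
    using that[of q u] rho_in[OF a] q assms by (auto simp: phi_def blk_def)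
qed

text \<open>In a face with two sides the two curves would meet at both ends of one edge, against
  \<open>apart_step\<close>.\<close>

lemma flen_ge_3:
  assumes "d \<in> darts" shows "3 \<le> flen d"
proof (rule card_orbit_ge_3[OF permutation_phi])
  show "phi d \<noteq> d" using phi_point[OF assms] by metis
  show "phi (phi d) \<noteq> d"
  proof
    assume dd: "phi (phi d) = d"
    obtain p \<theta> s where d: "d = (p, \<theta>, s)" using prod_cases3 .
    obtain q u where q: "phi (p, \<theta>, s) = (q, wrap (\<theta> + s * stp p \<theta> s), u)" "q \<noteq> p"
       "hc (\<theta> + s * stp p \<theta> s) q = hc (\<theta> + s * stp p \<theta> s) p"
      using phi_cases assms d by metis
    have "(q, wrap (\<theta> + s * stp p \<theta> s), u) \<in> darts" using phi_in[OF assms] d q by simp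
    from phi_cases[OF this] have "hc \<theta> p = hc \<theta> q"
      using dd d q by (metis hc_wrap prod.inject)
    then show False using q apart_step[of s p q \<theta>] assms d by (auto simp: darts_def)
  qed
qed

lemma blk_line:
  assumes "hc \<theta> q = hc \<theta> p" "q \<noteq> p" shows "P \<inter> line_through p q = blk p \<theta>"
  using line_through_iff[of \<theta> p q] assms by (auto simp: blk_def)

text \<open>The sides lie on the curves of three points and the corners are the lines through two of
  them, so the multiplicities are those in \<open>c_ordinary_triangle\<close>. The points are not
  collinear: \<open>p\<close> meets \<open>r\<close> at one end of an edge, hence not at the other
  end, where it meets \<open>q\<close>.\<close>

lemma triangle:
  assumes "d \<in> darts" "flen d = 3" and no: "\<And>a b c. \<not> c_ordinary_triangle m P a b c"
  shows "m < mult d \<or> m < mult (phi d) \<or> m < mult (phi (phi d))"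
proof (rule ccontr)
  assume neg: "\<not> ?thesis"
  obtain p \<theta> s where d: "d = (p, \<theta>, s)" using prod_cases3 .
  have s: "s = 1 \<or> s = - 1" and pP: "p \<in> P" using assms d by (auto simp: darts_def)
  define \<eta> where "\<eta> = \<theta> + s * stp p \<theta> s"
  obtain q u where q: "phi (p, \<theta>, s) = (q, wrap \<eta>, u)" "q \<in> P" "q \<noteq> p" "hc \<eta> q = hc \<eta> p"
    "mult (q, wrap \<eta>, u) = card (blk p \<eta>)"
    unfolding \<eta>_def using phi_cases assms d by metis
  have qd: "(q, wrap \<eta>, u) \<in> darts" using phi_in[OF assms(1)] d q by simp
  define \<zeta> where "\<zeta> = wrap \<eta> + u * stp q (wrap \<eta>) u"
  obtain r v where r: "phi (q, wrap \<eta>, u) = (r, wrap \<zeta>, v)" "r \<in> P" "r \<noteq> q" "hc \<zeta> r = hc \<zeta> q"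
    "mult (r, wrap \<zeta>, v) = card (blk q \<zeta>)"
    unfolding \<zeta>_def using phi_cases[OF qd] by metis
  have rd: "(r, wrap \<zeta>, v) \<in> darts" using phi_in[OF qd] r by simp
  have "phi (phi (phi d)) = d" using funpow_card_orbit[OF permutation_phi, of d] assms(2)
    by (simp add: numeral_3_eq_3)
  then have ddd: "phi (r, wrap \<zeta>, v) = (p, \<theta>, s)" using d q r by simp
  obtain t w where t: "phi (r, wrap \<zeta>, v) = (t, wrap (wrap \<zeta> + v * stp r (wrap \<zeta>) v), w)" "t \<noteq> r"
    "hc (wrap \<zeta> + v * stp r (wrap \<zeta>) v) t = hc (wrap \<zeta> + v * stp r (wrap \<zeta>) v) r"
    using phi_cases[OF rd] by metis
  have pr: "p \<noteq> r" "hc \<theta> p = hc \<theta> r"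
    using t ddd hc_wrap[of "wrap \<zeta> + v * stp r (wrap \<zeta>) v"] by (metis prod.inject)+
  have "hc \<eta> r \<noteq> hc \<eta> p" unfolding \<eta>_def using apart_step[OF s pP] pr by metis
  then have "\<not> collinear3 p q r" using collinear3_iff[of \<eta> p q r] q by simp
  moreover have "card (P \<inter> line_through p q) = mult (phi d)" using blk_line[OF q(4,3)] q d by simp
  moreover have "card (P \<inter> line_through q r) = mult (phi (phi d))" using blk_line[OF r(4,3)] q r d by simp
  moreover have "card (P \<inter> line_through p r) = mult d" using blk_line[of \<theta> r p] pr d by simp
  ultimately have "c_ordinary_triangle m P p q r"
    unfolding c_ordinary_triangle_def using pP q r neg by simp
  then show False using no by blast
qed

lemma mult_ge_2: "d \<in> darts \<Longrightarrow> 2 \<le> mult d"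
  using card_blk_ge_2_iff by (cases d) (auto simp: darts_def)

text \<open>If all multiplicities were at least 3, every term of the Euler sum would be at most 2/3
  + 1/3 - 1 = 0.\<close>

lemma sylvester_gallai: obtains p q where "p \<in> P" "q \<in> P" "p \<noteq> q" "card (P \<inter> line_through p q) = 2"
proof -
  have "\<exists>d\<in>darts. mult d < 3"
  proof (rule ccontr)
    assume "\<not> ?thesis"
    then have "2 / real (flen d) + 1 / real (mult d) - 1 \<le> 0" if "d \<in> darts" for d
    proof -
      have "2 / real (flen d) \<le> 2 / 3" using flen_ge_3[OF that] by (intro frac_le) auto
      moreover have "1 / real (mult d) \<le> 1 / 3"
        using \<open>\<not> (\<exists>d\<in>darts. mult d < 3)\<close> that by (intro frac_le) (auto simp: not_less)
      ultimately show ?thesis by simp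
    qed
    then show False using euler sum_nonpos[of darts "\<lambda>d. 2 / real (flen d) + 1 / real (mult d) - 1"] by force
  qed
  then obtain p \<theta> s where d: "(p, \<theta>, s) \<in> darts" "mult (p, \<theta>, s) = 2" using mult_ge_2 by force
  then obtain q where "p \<in> P" "q \<in> P" "q \<noteq> p" "hc \<theta> q = hc \<theta> p" by (auto simp: darts_def ev_def)
  then show ?thesis using that[of p q] blk_line d by auto
qed

section \<open>Vertices of multiplicity 2\<close>

lemma rho_nextI:
  assumes "p' \<in> blk p \<theta>" "tc \<theta> p < tc \<theta> p'"
    and min: "\<And>q. q \<in> blk p \<theta> \<Longrightarrow> tc \<theta> p < tc \<theta> q \<Longrightarrow> tc \<theta> p' \<le> tc \<theta> q"
  shows "rho (p, \<theta>, s) = (p', \<theta>, s)"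
proof -
  obtain r where r: "rho (p, \<theta>, s) = (r, \<theta>, s)" "r \<in> blk p \<theta>" "tc \<theta> p < tc \<theta> r"
    "\<And>q. q \<in> blk p \<theta> \<Longrightarrow> tc \<theta> p < tc \<theta> q \<Longrightarrow> tc \<theta> r \<le> tc \<theta> q"
    using rho_next[of p \<theta> s] assms(1,2) by metis
  have "tc \<theta> r = tc \<theta> p'" using r(4)[OF assms(1,2)] min[OF r(2,3)] by simp
  then show ?thesis using tc_inj_blk[OF r(2) assms(1)] r(1) by simp
qed

lemma rho_turnI:
  assumes "p \<in> P" "p' \<in> blk p \<theta>" and min: "\<And>q. q \<in> blk p \<theta> \<Longrightarrow> tc \<theta> p' \<le> tc \<theta> q"
    and max: "\<And>q. q \<in> blk p \<theta> \<Longrightarrow> tc \<theta> q \<le> tc \<theta> p"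
  shows "rho (p, \<theta>, s) = (p', \<theta>, - s)"
proof -
  have "\<not> (\<exists>q\<in>blk p \<theta>. tc \<theta> p < tc \<theta> q)" using max by (meson not_le)
  then obtain r where r: "rho (p, \<theta>, s) = (r, \<theta>, - s)" "r \<in> blk p \<theta>"
    "\<And>q. q \<in> blk p \<theta> \<Longrightarrow> tc \<theta> r \<le> tc \<theta> q"
    using rho_turn[of p \<theta> s] assms(1) by metis
  have "tc \<theta> r = tc \<theta> p'" using r(3)[OF assms(2)] min[OF r(2)] by simp
  then show ?thesis using tc_inj_blk[OF r(2) assms(2)] r(1) by simp
qed

text \<open>Such a vertex has four darts, and two turns lead to the opposite dart on the same
  curve.\<close>

lemma rho_rho:
  assumes "(p, \<theta>, s) \<in> darts" "mult (p, \<theta>, s) = 2"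
  shows "rho (rho (p, \<theta>, s)) = (p, \<theta>, - s)"
proof -
  have pP: "p \<in> P" using assms by (simp add: darts_def)
  obtain q where q: "q \<in> blk p \<theta>" "q \<noteq> p" using assms by (auto simp: darts_def ev_def blk_def)
  have "card {p, q} = card (blk p \<theta>)" using q assms by simp
  then have b: "blk p \<theta> = {p, q}" using blk_self[OF pP] q by (metis card_subset_eq empty_subsetI finite_blk insert_subset)
  have b': "blk q \<theta> = {p, q}" using blk_eq[OF q(1)] b by simp
  have qP: "q \<in> P" using q by (simp add: blk_def)
  have ne: "tc \<theta> q \<noteq> tc \<theta> p" using tc_inj_blk[OF q(1) blk_self[OF pP]] q by blast
  show ?thesis
  proof (cases "tc \<theta> p < tc \<theta> q")
    case True
    have "rho (p, \<theta>, s) = (q, \<theta>, s)" using b True by (intro rho_nextI) auto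
    moreover have "rho (q, \<theta>, s) = (p, \<theta>, - s)" using b' True qP by (intro rho_turnI) auto
    ultimately show ?thesis by simp
  next
    case False
    have "rho (p, \<theta>, s) = (q, \<theta>, - s)" using b False ne pP by (intro rho_turnI) auto
    moreover have "rho (q, \<theta>, - s) = (p, \<theta>, - s)" using b' False ne by (intro rho_nextI) auto
    ultimately show ?thesis by simp
  qed
qed

section \<open>Ladders and discharging\<close>

text \<open>For \<open>b\<close> and \<open>c\<close> off the exceptional line through
  \<open>p\<close>, the lines from \<open>p\<close> to them are distinct and ordinary. As
  \<open>p\<close>, \<open>b\<close>, \<open>c\<close> is no 11-ordinary triangle, the line
  \<open>bc\<close> has at least 12 points. So the points off the exceptional line span no ordinary
  line and are collinear.\<close>

lemma only_one_nonordinary_line: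
  assumes no: "\<And>a b c. \<not> c_ordinary_triangle 11 P a b c"
    and p: "p \<in> P" and s: "s = 1 \<or> s = - 1"
    and ord: "\<And>x. 0 < x \<Longrightarrow> x < pi \<Longrightarrow> \<alpha> + s * x \<in> ev p \<Longrightarrow> card (blk p (\<alpha> + s * x)) = 2"
  obtains L1 L2 where "is_line L1" "is_line L2" "P \<subseteq> L1 \<union> L2"
proof -
  define Q where "Q = P - blk p \<alpha>"
  have finQ: "finite Q" and QP: "Q \<subseteq> P" using finite_P by (auto simp: Q_def)
  have two: "\<exists>\<theta>. hc \<theta> b = hc \<theta> p \<and> blk p \<theta> = {p, b} \<and> p \<noteq> b" if b: "b \<in> Q" for b
  proof -
    obtain x where x: "0 < x" "x \<le> pi" "hc (\<alpha> + s * x) b = hc (\<alpha> + s * x) p" using ex_angle[OF s] by blast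
    have "hc \<alpha> b \<noteq> hc \<alpha> p" using b by (auto simp: Q_def blk_def)
    then have ne: "b \<noteq> p" "x \<noteq> pi" using x hc_add_pi_mult[of "s * pi" \<alpha> b p] s by auto
    have bP: "b \<in> P" using b QP by blast
    then have "\<alpha> + s * x \<in> ev p" using x ne by (auto simp: ev_def)
    then have "card (blk p (\<alpha> + s * x)) = card {p, b}" using ord x ne by auto
    moreover have "{p, b} \<subseteq> blk p (\<alpha> + s * x)" using x bP p by (auto simp: blk_def)
    ultimately have "blk p (\<alpha> + s * x) = {p, b}" using card_subset_eq[OF finite_blk] by metis
    then show ?thesis using x ne by blast
  qed
  have rich: "card (Q \<inter> line_through b c) \<noteq> 2" if bc: "b \<in> Q" "c \<in> Q" "b \<noteq> c" for b c
  proof -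
    obtain \<beta> where \<beta>: "hc \<beta> b = hc \<beta> p" "blk p \<beta> = {p, b}" "p \<noteq> b" using two bc by metis
    obtain \<gamma> where \<gamma>: "hc \<gamma> c = hc \<gamma> p" "blk p \<gamma> = {p, c}" "p \<noteq> c" using two bc by metis
    have P: "b \<in> P" "c \<in> P" using bc QP by auto
    have "c \<notin> blk p \<beta>" using \<beta> bc \<gamma> by auto
    then have "hc \<beta> c \<noteq> hc \<beta> p" using P by (simp add: blk_def)
    then have "\<not> collinear3 p b c" using collinear3_iff[of \<beta> p b c] \<beta> by simp
    moreover have "card (P \<inter> line_through p b) \<le> 11" "card (P \<inter> line_through p c) \<le> 11"
      using blk_line[of \<beta> b p] blk_line[of \<gamma> c p] \<beta> \<gamma> by auto
    ultimately have big: "12 \<le> card (P \<inter> line_through b c)"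
      using no[of p b c] p P by (auto simp: c_ordinary_triangle_def)
    obtain \<theta> where \<theta>: "hc \<theta> b = hc \<theta> c" using ex_common_hc .
    have on: "r \<in> line_through b c \<longleftrightarrow> hc \<theta> r = hc \<theta> b" for r using line_through_iff[OF \<theta> bc(3)] .
    \<comment> \<open>The exceptional line misses \<open>b\<close>, so it takes at most one point
      from the line \<open>bc\<close>, and at least 11 remain in \<open>Q\<close>.\<close>
    have "u = v" if uv: "u \<in> blk p \<alpha> \<inter> line_through b c" "v \<in> blk p \<alpha> \<inter> line_through b c" for u v
    proof (rule ccontr)
      assume "u \<noteq> v"
      have h: "hc \<alpha> u = hc \<alpha> p" "hc \<alpha> v = hc \<alpha> p" "hc \<theta> u = hc \<theta> b" "hc \<theta> v = hc \<theta> b"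
        using uv on by (auto simp: blk_def)
      then have "sin (\<theta> - \<alpha>) = 0" using sin_eq_0_if_hc[of \<alpha> u v "\<theta> - \<alpha>"] \<open>u \<noteq> v\<close> by simp
      then have "hc \<alpha> b = hc \<alpha> p" using hc_add_pi_mult[of "\<theta> - \<alpha>" \<alpha> b u] h by simp
      then show False using bc(1) by (simp add: Q_def blk_def)
    qed
    then obtain w where "blk p \<alpha> \<inter> line_through b c \<subseteq> {w}" by blast
    then have "P \<inter> line_through b c \<subseteq> insert w (Q \<inter> line_through b c)" by (auto simp: Q_def)
    then have "card (P \<inter> line_through b c) \<le> card (insert w (Q \<inter> line_through b c))"
      using finQ by (intro card_mono) auto
    also have "\<dots> \<le> Suc (card (Q \<inter> line_through b c))" using card_insert_le_m1 by (simp add: card_insert_if finQ)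
    finally show ?thesis using big by linarith
  qed
  have "collinear3 a b c" if abc: "a \<in> Q" "b \<in> Q" "c \<in> Q" for a b c
  proof (rule ccontr)
    assume "\<not> collinear3 a b c"
    then interpret Q: point_config Q
      using finQ abc by unfold_locales blast+
    show False using Q.sylvester_gallai rich by metis
  qed
  then obtain L where "is_line L" "Q \<subseteq> L" using collinear_subset_line by blast
  moreover have "P \<subseteq> {r. hc \<alpha> r = hc \<alpha> p} \<union> Q" by (auto simp: Q_def blk_def)
  ultimately show ?thesis using that is_line_hc by blast
qed

lemma fst_alp: "fst (alp d) = fst d"
  by (cases d) auto

lemma mult_alp: "d \<in> darts \<Longrightarrow> mult (alp d) = mult (phi d)"
  using rho_in(2)[OF alp_in] by (simp add: phi_def)

lemma phi_alp: "d \<in> darts \<Longrightarrow> phi (alp d) = rho d"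
  using alp_in alp_alp by (simp add: phi_def)

lemma rho_cycle: 
  assumes "d \<in> darts" "mult d = 2"
  shows "fst (rho (rho d)) = fst d" "rho (rho (rho (rho d))) = d"
proof -
  obtain p \<theta> s where d: "d = (p, \<theta>, s)" using prod_cases3 .
  have "(p, \<theta>, - s) \<in> darts" using assms d by (auto simp: darts_def)
  then show "fst (rho (rho d)) = fst d" "rho (rho (rho (rho d))) = d"
    using assms d rho_rho[of p \<theta> s] rho_rho[of p \<theta> "- s"] by simp_all
qed

text \<open>With only two curves at the far end of \<open>e\<close>, the faces on both sides of
  \<open>e\<close> continue along the same other curve. Its dart opposite to \<open>phi e\<close>,
  reversed, runs into \<open>alp e\<close>.\<close>

lemma phi_preimage:
  assumes "e \<in> darts" "mult (alp e) = 2"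
  obtains z where "z \<in> darts" "phi z = alp e" "fst z = fst (phi e)"
proof -
  let ?f = "phi e"
  have f: "?f = rho (alp e)" "?f \<in> darts" "mult ?f = 2"
    using assms phi_in mult_alp by (auto simp: phi_def)
  have r: "rho (rho ?f) \<in> darts" using rho_in(1) f by blast
  show ?thesis
  proof (rule that)
    show "alp (rho (rho ?f)) \<in> darts" using alp_in r .
    show "phi (alp (rho (rho ?f))) = alp e"
      using phi_alp[OF r] f rho_cycle(2)[OF alp_in[OF assms(1)] assms(2)] by simp
    show "fst (alp (rho (rho ?f))) = fst ?f" using fst_alp rho_cycle(1) f by simp
  qed
qed

text \<open>\<open>phi\<close> makes one turn from the reversed dart; one more gives its opposite,
  which prolongs the edge on the curve of \<open>p\<close>.\<close>

lemma phi_straight: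
  assumes "(p, \<theta>, s) \<in> darts" "mult (phi (p, \<theta>, s)) = 2"
  shows "rho (phi (p, \<theta>, s)) = (p, wrap (\<theta> + s * stp p \<theta> s), s)"
    and "card (blk p (\<theta> + s * stp p \<theta> s)) = 2"
proof -
  have a: "alp (p, \<theta>, s) \<in> darts" "mult (alp (p, \<theta>, s)) = 2"
    using alp_in[OF assms(1)] mult_alp[OF assms(1)] assms(2) by simp_all
  then show "rho (phi (p, \<theta>, s)) = (p, wrap (\<theta> + s * stp p \<theta> s), s)"
    using rho_rho[of p "wrap (\<theta> + s * stp p \<theta> s)" "- s"] assms(1) by (simp add: phi_def)
  show "card (blk p (\<theta> + s * stp p \<theta> s)) = 2" using a(2) by simp
qed

text \<open>The vertices of \<open>d\<close> and \<open>phi d\<close> are the two ends of the edge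
  \<open>d\<close>.\<close>

definition ordinary_edges where "ordinary_edges = {d\<in>darts. mult d = 2 \<and> mult (phi d) = 2}"

definition triangle_edges where "triangle_edges = {d\<in>ordinary_edges. flen d = 3}"

definition quad_edges where
  "quad_edges = {d\<in>ordinary_edges. flen d = 4 \<and> mult (phi (phi d)) = 2 \<and> mult (phi (phi (phi d))) = 2}"

text \<open>In a quadrilateral \<open>phi (phi d)\<close> is the side opposite \<open>d\<close>;
  \<open>alp\<close> then enters the face behind it.\<close>

definition across :: "dart \<Rightarrow> dart" where
  "across d = alp (phi (phi d))"

lemma flen_phi [simp]: "flen (phi d) = flen d"
  using permutation_orbit_step[OF permutation_phi] by simp

lemma across_quad:
  assumes "d \<in> quad_edges"
  shows "across d \<in> ordinary_edges"
proof -
  have d: "d \<in> darts" "mult (phi (phi d)) = 2" "mult (phi (phi (phi d))) = 2"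
    using assms by (auto simp: quad_edges_def ordinary_edges_def)
  have "phi (phi d) \<in> darts" using phi_in d by blast
  then show ?thesis
    using alp_in mult_alp phi_alp rho_in(2) d by (simp add: across_def ordinary_edges_def)
qed

lemma alp_triangle:
  assumes "d \<in> ordinary_edges" shows "alp d \<in> ordinary_edges"
  using assms alp_in mult_alp phi_alp rho_in(2) by (simp add: ordinary_edges_def)

text \<open>A ladder of quadrilaterals that leaves a triangle with apex \<open>A\<close> runs between two lines
  through \<open>A\<close>. If it reached a second triangle, its apex would be the next common point of these lines, which
  is \<open>A\<close> again; so all other points on these lines would have multiplicity two.\<close>
lemma ladder_avoids_triangles:
  assumes no: "\<And>a b c. \<not> c_ordinary_triangle 11 P a b c"
    and two_lines: "\<not> (\<exists>L1 L2. is_line L1 \<and> is_line L2 \<and> P \<subseteq> L1 \<union> L2)"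
    and d: "d \<in> triangle_edges"
    and ladder: "\<forall>i<t. (across ^^ i) (alp d) \<in> quad_edges"
  shows "(across ^^ t) (alp d) \<notin> triangle_edges"
proof
  assume last: "(across ^^ t) (alp d) \<in> triangle_edges"
  have dd: "d \<in> darts" "mult d = 2" "mult (phi d) = 2" "phi (phi (phi d)) = d"
    using d funpow_card_orbit[OF permutation_phi, of d]
    by (auto simp: triangle_edges_def ordinary_edges_def numeral_3_eq_3)
  obtain p \<alpha> s where apex: "phi (phi d) = (p, \<alpha>, s)" using prod_cases3 .
  have pd: "(p, \<alpha>, s) \<in> darts" using phi_in dd apex by metis
  then have p: "p \<in> P" and s: "s = 1 \<or> s = - 1" by (auto simp: darts_def)
  define p' where "p' = fst (phi d)"
  have p'p: "p' \<noteq> p" using phi_point[OF phi_in[OF dd(1)]] apex by (simp add: p'_def)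
  have hp': "hc \<alpha> p' = hc \<alpha> p"
  proof -
    obtain \<beta> u where f: "phi d = (p', \<beta>, u)" unfolding p'_def by (metis prod.collapse)
    then have "(p', \<beta>, u) \<in> darts" using phi_in dd by metis
    from phi_cases[OF this] show ?thesis using apex f by (metis hc_wrap prod.inject)
  qed
  \<comment> \<open>The rails of the ladder: after the rung \<open>x\<close> the face continues on
    the curve of \<open>p\<close>, outwards at angle \<open>l\<close> from the apex and with all
    vertices so far of multiplicity 2; before \<open>x\<close> it comes along the curve of
    \<open>p'\<close>.\<close>
  define inv where "inv x \<longleftrightarrow> (\<exists>l>0. phi x = (p, wrap (\<alpha> + s * l), s) \<and>
      (\<forall>y. 0 < y \<longrightarrow> y \<le> l \<longrightarrow> \<alpha> + s * y \<in> ev p \<longrightarrow> card (blk p (\<alpha> + s * y)) = 2)) \<and>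
      (\<exists>z\<in>darts. phi z = x \<and> fst z = p')" for x
  have ladder_inv: "i \<le> t \<Longrightarrow> inv ((across ^^ i) (alp d))" for i
  proof (induction i)
    case 0
    have m: "mult (phi (p, \<alpha>, s)) = 2" using dd apex by metis
    have "phi (alp d) = rho (phi (p, \<alpha>, s))" using phi_alp dd apex by metis
    then have 1: "phi (alp d) = (p, wrap (\<alpha> + s * stp p \<alpha> s), s)" using phi_straight(1)[OF pd m] by simp
    have 2: "card (blk p (\<alpha> + s * y)) = 2" if "0 < y" "y \<le> stp p \<alpha> s" "\<alpha> + s * y \<in> ev p" for y
      using stp_least[OF s, of y p \<alpha>] phi_straight(2)[OF pd m] that by (cases "y = stp p \<alpha> s") auto
    obtain z where "z \<in> darts" "phi z = alp d" "fst z = p'"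
      using phi_preimage[of d] dd mult_alp p'_def by metis
    then show ?case unfolding inv_def using 1 2 stp_pos[OF s, of p \<alpha>] by (auto simp del: alp.simps)
  next
    case (Suc i)
    let ?x = "(across ^^ i) (alp d)"
    have q: "?x \<in> quad_edges" using ladder Suc.prems by simp
    then have x: "?x \<in> darts" "mult (phi (phi ?x)) = 2" "mult (phi (phi (phi ?x))) = 2"
        "phi (phi (phi (phi ?x))) = ?x"
      using funpow_card_orbit[OF permutation_phi, of ?x]
      by (auto simp: quad_edges_def ordinary_edges_def numeral_eq_Suc)
    obtain l z where l: "l > 0" "phi ?x = (p, wrap (\<alpha> + s * l), s)"
      "\<And>y. 0 < y \<Longrightarrow> y \<le> l \<Longrightarrow> \<alpha> + s * y \<in> ev p \<Longrightarrow> card (blk p (\<alpha> + s * y)) = 2"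
      and z: "z \<in> darts" "phi z = ?x" "fst z = p'"
      using Suc.IH Suc.prems unfolding inv_def by auto
    let ?e = "stp p (\<alpha> + s * l) s"
    have pd': "(p, wrap (\<alpha> + s * l), s) \<in> darts" using phi_in x l by metis
    have m: "mult (phi (p, wrap (\<alpha> + s * l), s)) = 2" using x l by metis
    have "phi (across ?x) = rho (phi (phi ?x))" using phi_alp phi_in x by (simp add: across_def)
    then have 1: "phi (across ?x) = (p, wrap (\<alpha> + s * (l + ?e)), s)"
      using phi_straight(1)[OF pd' m] l by (simp add: wrap_wrap_add algebra_simps)
    have c2: "card (blk p (\<alpha> + s * (l + ?e))) = 2"
      using phi_straight(2)[OF pd' m] blk_wrap[of p "wrap (\<alpha> + s * l) + s * ?e"]
      by (simp add: wrap_wrap_add algebra_simps)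
    have 2: "card (blk p (\<alpha> + s * y)) = 2" if y: "0 < y" "y \<le> l + ?e" "\<alpha> + s * y \<in> ev p" for y
    proof -
      consider "y \<le> l" | "l < y" "y < l + ?e" | "y = l + ?e" using y by linarith
      then show ?thesis
      proof cases
        case 2
        then have "\<alpha> + s * l + s * (y - l) \<notin> ev p" by (intro stp_least[OF s]) auto
        then show ?thesis using y by (simp add: algebra_simps)
      qed (use l y c2 in auto)
    qed
    have "mult (alp (phi (phi ?x))) = 2" using mult_alp phi_in x by simp
    then obtain z' where z': "z' \<in> darts" "phi z' = across ?x" "fst z' = fst (phi (phi (phi ?x)))"
      using phi_preimage[of "phi (phi ?x)"] phi_in x across_def by metis
    \<comment> \<open>The dart before the rung is the fourth side of the quadrilateral, so the
      second rail stays on \<open>p'\<close>.\<close>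
    have "phi (phi (phi (phi ?x))) = phi z" using x z by simp
    then have "phi (phi (phi ?x)) = z" using permutes_inj[OF phi_permutes] by (simp add: inj_eq)
    then have "fst z' = p'" using z' z by simp
    then show ?case unfolding inv_def using 1 2 z' l(1) stp_pos[OF s, of p "\<alpha> + s * l"]
      by (auto intro!: exI[of _ "l + ?e"] bexI[of _ z'])
  qed
  let ?x = "(across ^^ t) (alp d)"
  have x: "?x \<in> darts" "phi (phi (phi ?x)) = ?x"
    using last funpow_card_orbit[OF permutation_phi, of ?x]
    by (auto simp: triangle_edges_def ordinary_edges_def numeral_3_eq_3)
  obtain l z where l: "l > 0" "phi ?x = (p, wrap (\<alpha> + s * l), s)"
    "\<And>y. 0 < y \<Longrightarrow> y \<le> l \<Longrightarrow> \<alpha> + s * y \<in> ev p \<Longrightarrow> card (blk p (\<alpha> + s * y)) = 2"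
    and z: "z \<in> darts" "phi z = ?x" "fst z = p'"
    using ladder_inv[of t] unfolding inv_def by auto
  let ?e = "stp p (\<alpha> + s * l) s"
  \<comment> \<open>In the last triangle the other two sides are on both rails, so \<open>p\<close>
    and \<open>p'\<close> meet at its apex.\<close>
  have "phi (phi (phi ?x)) = phi z" using x z by simp
  then have zz: "phi (p, wrap (\<alpha> + s * l), s) = z" using permutes_inj[OF phi_permutes] l by (simp add: inj_eq)
  have "(p, wrap (\<alpha> + s * l), s) \<in> darts" using phi_in x l by metis
  from phi_cases[OF this] have "hc (wrap (\<alpha> + s * l) + s * ?e) p' = hc (wrap (\<alpha> + s * l) + s * ?e) p"
    using zz z by (metis fst_conv stp_wrap)
  then have "hc (wrap (wrap (\<alpha> + s * l) + s * ?e)) p' = hc (wrap (wrap (\<alpha> + s * l) + s * ?e)) p" by simp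
  then have "hc (\<alpha> + s * l + s * ?e) p' = hc (\<alpha> + s * l + s * ?e) p" unfolding wrap_wrap_add by simp
  \<comment> \<open>They also meet at \<open>\<alpha>\<close>, so the ladder spans at least half a
    turn.\<close>
  then have "sin (s * (l + ?e)) = 0"
    using sin_eq_0_if_hc[of \<alpha> p' p "s * (l + ?e)"] hp' p'p by (simp add: algebra_simps)
  then have "sin (l + ?e) = 0" using s sin_minus[of "l + ?e"] by auto
  moreover have "0 < l + ?e" using l(1) stp_pos[OF s, of p "\<alpha> + s * l"] by linarith
  ultimately have far: "pi \<le> l + ?e" using sin_gt_zero[of "l + ?e"] by (cases "l + ?e < pi") auto
  have between: "card (blk p (\<alpha> + s * y)) = 2" if y: "0 < y" "y < pi" "\<alpha> + s * y \<in> ev p" for y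
  proof (cases "y \<le> l")
    case False
    then have "\<alpha> + s * l + s * (y - l) \<notin> ev p" using y far by (intro stp_least[OF s]) auto
    then show ?thesis using y by (simp add: algebra_simps)
  qed (use l y in auto)
  show False
  proof (rule only_one_nonordinary_line[OF no p s])
    show "card (blk p (\<alpha> + s * y)) = 2" if "0 < y" "y < pi" "\<alpha> + s * y \<in> ev p" for y
      using between that .
  qed (use two_lines in blast)
qed

text \<open>The ladders are trails of \<open>across\<close> in \<open>quad_edges\<close> that start
  behind the triangle edges. No ladder starts in the middle of another, since the face before a
  start is a triangle and not a quadrilateral.\<close>

lemma card_triangle_edges_le:
  assumes "\<And>a b c. \<not> c_ordinary_triangle 11 P a b c"
    and "\<not> (\<exists>L1 L2. is_line L1 \<and> is_line L2 \<and> P \<subseteq> L1 \<union> L2)"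
  shows "card triangle_edges \<le> card (ordinary_edges - quad_edges - triangle_edges)"
proof -
  have inj: "inj_on alp darts" using alp_alp by (metis inj_onI)
  have sub: "triangle_edges \<subseteq> ordinary_edges" "quad_edges \<subseteq> ordinary_edges" "ordinary_edges \<subseteq> darts"
    by (auto simp: triangle_edges_def quad_edges_def ordinary_edges_def)
  have "card (alp ` triangle_edges) \<le> card (ordinary_edges - quad_edges - triangle_edges)"
  proof (rule card_trail_starts_le)
    show "finite ordinary_edges" using finite_darts sub finite_subset by blast
    show "inj_on across quad_edges"
    proof (rule inj_onI)
      fix d e assume de: "d \<in> quad_edges" "e \<in> quad_edges" "across d = across e"
      then have "d \<in> darts" "e \<in> darts" using sub by auto
      then have "phi (phi d) = phi (phi e)" using de inj phi_in by (metis across_def inj_onD)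
      then show "d = e" using permutes_inj[OF phi_permutes] by (simp add: inj_eq)
    qed
    show "across ` quad_edges \<subseteq> ordinary_edges" using across_quad by blast
    show "alp ` triangle_edges \<subseteq> ordinary_edges" using alp_triangle sub by blast
    show "alp ` triangle_edges \<inter> across ` quad_edges = {}"
    proof (rule ccontr)
      assume "\<not> ?thesis"
      then obtain d e where de: "d \<in> triangle_edges" "e \<in> quad_edges" "alp d = across e" by blast
      then have "d \<in> darts" "e \<in> darts" using sub by auto
      then have "d = phi (phi e)" using de inj phi_in by (metis across_def inj_onD)
      then show False using de by (simp add: triangle_edges_def quad_edges_def)
    qed
    fix e t assume "e \<in> alp ` triangle_edges" "\<forall>i<t. (across ^^ i) e \<in> quad_edges"
    then show "(across ^^ t) e \<notin> triangle_edges" using ladder_avoids_triangles[OF assms] by blast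
  qed (use sub in auto)
  moreover have "card (alp ` triangle_edges) = card triangle_edges"
    using inj sub inj_on_subset card_image by (metis order_trans)
  ultimately show ?thesis by simp
qed

lemma two_lines_or_ordinary_triangle:
  assumes no: "\<And>a b c. \<not> c_ordinary_triangle 11 P a b c"
  shows "\<exists>L1 L2. is_line L1 \<and> is_line L2 \<and> P \<subseteq> L1 \<union> L2"
proof (rule ccontr)
  assume two_lines: "\<not> ?thesis"
  define bad where "bad = ordinary_edges - quad_edges - triangle_edges"
  define c where "c d = 4 / real (flen d) + 2 / real (mult d) - 2" for d
  \<comment> \<open>Each triangle edge gives up 1/6 and each edge in \<open>bad\<close> receives
    1/6. By \<open>card_triangle_edges_le\<close> the total does not drop below the sum of
    \<open>c\<close>, twice the Euler sum. Yet it is nonpositive on the faces of length 3, of length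
    4 and of length at least 5.\<close>
  define h where "h d = c d - of_bool (d \<in> triangle_edges) / 6 + of_bool (d \<in> bad) / 6" for d
  have le: "2 / real (mult d) \<le> 1" if "d \<in> darts" for d using mult_ge_2[OF that] by simp
  have le3: "mult d = 2 \<or> 2 / real (mult d) \<le> 2 / 3" if "d \<in> darts" for d
    using mult_ge_2[OF that] frac_le[of 2 2 3 "real (mult d)"] by (cases "mult d = 2") auto
  have le12: "2 / real (mult d) \<le> 1 / 6" if "d \<in> darts" "11 < mult d" for d
    using frac_le[of 2 2 12 "real (mult d)"] that by simp
  let ?D = "\<lambda>k. {d\<in>darts. flen d = k}"
  have perm: "(\<Sum>d\<in>?D k. g (phi d)) = sum g (?D k)" for g :: "_ \<Rightarrow> real" and k
    by (rule sum_permutes[OF phi_permutes]) (auto simp: phi_in)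
  have "(\<Sum>d\<in>?D 3. h d) \<le> 0"
  proof -
    \<comment> \<open>Here 4/3 - 2 = -2/3, and \<open>x\<close> belongs to the rich corner. If both
      other corners have multiplicity 2, the surplus 1/6 + 1 + 1 - 2 is what the edge between them
      gave up; otherwise the sum is at most 1/6 + 1 + 2/3 - 2 < 0.\<close>
    have corner: "(x - 2 / 3 - of_bool (X \<and> Y) / 6) + (y - 2 / 3 - of_bool (Y \<and> Z) / 6)
        + (z - 2 / 3 - of_bool (Z \<and> X) / 6) \<le> 0"
      if "x \<le> 1 / 6" "y \<le> 1" "z \<le> 1" "Y \<or> y \<le> 2 / 3" "Z \<or> z \<le> 2 / 3" for x y z :: real and X Y Z
      by (cases Y; cases Z) (use that in \<open>auto simp: of_bool_def\<close>)
    have "h d + h (phi d) + h (phi (phi d)) \<le> 0" if d: "d \<in> ?D 3" for d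
    proof -
      have dd: "d \<in> darts" "phi d \<in> darts" "phi (phi d) \<in> darts" "phi (phi (phi d)) = d"
        using d phi_in funpow_card_orbit[OF permutation_phi, of d] by (auto simp: numeral_3_eq_3)
      have T: "e \<in> triangle_edges \<longleftrightarrow> mult e = 2 \<and> mult (phi e) = 2" if "e \<in> ?D 3" for e
        using that by (auto simp: triangle_edges_def ordinary_edges_def)
      have he: "h e = 2 / real (mult e) - 2 / 3 - of_bool (mult e = 2 \<and> mult (phi e) = 2) / 6"
        if "e \<in> ?D 3" for e
        using that T[OF that] by (auto simp: h_def c_def bad_def ordinary_edges_def)
      have eqs: "h d = 2 / real (mult d) - 2 / 3 - of_bool (mult d = 2 \<and> mult (phi d) = 2) / 6"
        "h (phi d) = 2 / real (mult (phi d)) - 2 / 3 - of_bool (mult (phi d) = 2 \<and> mult (phi (phi d)) = 2) / 6"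
        "h (phi (phi d)) = 2 / real (mult (phi (phi d))) - 2 / 3 - of_bool (mult (phi (phi d)) = 2 \<and> mult d = 2) / 6"
        using he[of d] he[of "phi d"] he[of "phi (phi d)"] d dd by simp_all
      consider "11 < mult d" | "11 < mult (phi d)" | "11 < mult (phi (phi d))"
        using triangle[OF dd(1) _ no] d by auto
      then show ?thesis
      proof cases
        case 1
        then show ?thesis
          using corner[where X = "mult d = 2" and Y = "mult (phi d) = 2" and Z = "mult (phi (phi d)) = 2",
              OF le12[OF dd(1) 1] le[OF dd(2)] le[OF dd(3)] le3[OF dd(2)] le3[OF dd(3)]]
          unfolding eqs by (simp only: ac_simps)
      next
        case 2
        then show ?thesis
          using corner[where X = "mult (phi d) = 2" and Y = "mult (phi (phi d)) = 2" and Z = "mult d = 2",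
              OF le12[OF dd(2) 2] le[OF dd(3)] le[OF dd(1)] le3[OF dd(3)] le3[OF dd(1)]]
          unfolding eqs by (simp only: ac_simps)
      next
        case 3
        then show ?thesis
          using corner[where X = "mult (phi (phi d)) = 2" and Y = "mult d = 2" and Z = "mult (phi d) = 2",
              OF le12[OF dd(3) 3] le[OF dd(1)] le[OF dd(2)] le3[OF dd(1)] le3[OF dd(2)]]
          unfolding eqs by (simp only: ac_simps)
      qed
    qed
    then have "(\<Sum>d\<in>?D 3. h d + h (phi d) + h (phi (phi d))) \<le> 0" by (rule sum_nonpos)
    \<comment> \<open>The bound per face is summed over all three darts of each face, which gives
      three times the sum.\<close>
    moreover have "(\<Sum>d\<in>?D 3. h (phi d)) = sum h (?D 3)" "(\<Sum>d\<in>?D 3. h (phi (phi d))) = sum h (?D 3)"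
      using perm[of h 3] perm[of "\<lambda>d. h (phi d)" 3] by simp_all
    ultimately show ?thesis by (simp add: sum.distrib)
  qed
  moreover have "(\<Sum>d\<in>?D 4. h d) \<le> 0"
  proof -
    define n where "n d = (of_bool (mult d \<noteq> 2) :: real)" for d
    \<comment> \<open>A corner of multiplicity above 2 has \<open>c\<close> at most -1/3 and pays
      1/6 to each of the two sides that do not touch it; shifting by \<open>phi\<close> makes the
      bounds cancel.\<close>
    have "h d \<le> (n (phi (phi d)) + n (phi (phi (phi d))) - 2 * n d) / 6" if d: "d \<in> ?D 4" for d
    proof -
      have "c d \<le> - n d / 3" using d le[of d] le3[of d] by (auto simp: c_def n_def)
      moreover have "d \<notin> triangle_edges" using d by (auto simp: triangle_edges_def)
      moreover have "of_bool (d \<in> bad) \<le> n (phi (phi d)) + n (phi (phi (phi d)))"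
        using d by (auto simp: bad_def n_def quad_edges_def)
      ultimately show ?thesis by (simp add: h_def)
    qed
    then have "(\<Sum>d\<in>?D 4. h d) \<le> (\<Sum>d\<in>?D 4. (n (phi (phi d)) + n (phi (phi (phi d))) - 2 * n d) / 6)"
      by (rule sum_mono)
    also have "\<dots> = ((\<Sum>d\<in>?D 4. n (phi (phi d))) + (\<Sum>d\<in>?D 4. n (phi (phi (phi d)))) - 2 * (\<Sum>d\<in>?D 4. n d)) / 6"
      by (simp only: sum_divide_distrib[symmetric] sum.distrib sum_subtractf sum_distrib_left)
    also have "\<dots> = 0"
      using perm[of n 4] perm[of "\<lambda>d. n (phi d)" 4] perm[of "\<lambda>d. n (phi (phi d))" 4] by simp
    finally show ?thesis .
  qed
  moreover have "(\<Sum>d\<in>{d\<in>darts. 5 \<le> flen d}. h d) \<le> 0"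
  proof (rule sum_nonpos)
    fix d assume d: "d \<in> {d\<in>darts. 5 \<le> flen d}"
    \<comment> \<open>So \<open>c d\<close> is at most 4/5 + 1 - 2 = -1/5, which covers the 1/6
      received.\<close>
    then have "4 / real (flen d) \<le> 4 / 5" by (intro frac_le) auto
    moreover have "of_bool (d \<in> bad) \<le> (1::real)" by simp
    ultimately show "h d \<le> 0" using le[of d] d by (simp add: h_def c_def)
  qed
  moreover have "(\<Sum>d\<in>darts. h d) = (\<Sum>d\<in>?D 3. h d) + (\<Sum>d\<in>?D 4. h d) + (\<Sum>d\<in>{d\<in>darts. 5 \<le> flen d}. h d)"
  proof -
    have "darts = ?D 3 \<union> ?D 4 \<union> {d\<in>darts. 5 \<le> flen d}" using flen_ge_3 by force
    then have "sum h darts = sum h (?D 3 \<union> ?D 4 \<union> {d\<in>darts. 5 \<le> flen d})" by simp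
    also have "\<dots> = sum h (?D 3 \<union> ?D 4) + sum h {d\<in>darts. 5 \<le> flen d}"
      using finite_darts by (intro sum.union_disjoint) auto
    also have "sum h (?D 3 \<union> ?D 4) = sum h (?D 3) + sum h (?D 4)"
      using finite_darts by (intro sum.union_disjoint) auto
    finally show ?thesis .
  qed
  moreover have "(\<Sum>d\<in>darts. h d) = (\<Sum>d\<in>darts. c d) - card triangle_edges / 6 + card bad / 6"
  proof -
    have "(\<Sum>d\<in>darts. of_bool (d \<in> A) :: real) = card A" if "A \<subseteq> darts" for A
      using that finite_darts by (simp add: of_bool_def sum.If_cases Int_absorb1)
    moreover have "triangle_edges \<subseteq> darts" "bad \<subseteq> darts"
      by (auto simp: triangle_edges_def bad_def ordinary_edges_def)
    ultimately show ?thesis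
      by (simp add: h_def sum.distrib sum_subtractf flip: sum_divide_distrib)
  qed
  moreover have "real (card triangle_edges) \<le> real (card bad)"
    using card_triangle_edges_le[OF no two_lines] by (simp add: bad_def)
  moreover have "(\<Sum>d\<in>darts. c d) > 0"
  proof -
    have "(\<Sum>d\<in>darts. c d) = 2 * (\<Sum>d\<in>darts. 2 / real (flen d) + 1 / real (mult d) - 1)"
      unfolding sum_distrib_left by (intro sum.cong) (auto simp: c_def)
    then show ?thesis using euler by simp
  qed
  ultimately show False by linarith
qed

end

theorem theorem1:
  fixes P :: "point set" and n :: nat
  assumes "finite P" and "card P = n"
    and "\<not> (\<exists>L1 L2. is_line L1 \<and> is_line L2 \<and> P \<subseteq> L1 \<union> L2)"
    and "n > 7697"
  shows "\<exists>a b d. c_ordinary_triangle 11 P a b d"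
proof (rule ccontr)
  assume no: "\<not> ?thesis"
  interpret point_config P
  proof
    show "\<exists>a\<in>P. \<exists>b\<in>P. \<exists>c\<in>P. \<not> collinear3 a b c"
    proof (rule ccontr)
      assume "\<not> ?thesis"
      then obtain L where "is_line L" "P \<subseteq> L" using collinear_subset_line[of P] by blast
      then show False using assms(3) by blast
    qed
  qed (rule assms(1))
  show False using two_lines_or_ordinary_triangle no assms(3) by blast
qed

end
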